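(* If $\Omega\subset\mathbb{R}^2$ is non-empty, open and simply connected with finite measure, then $$\Phi_{1,\infty}(\Omega)<\Bigg(1-\frac{3^4}{12801\cdot 2^{31}\Big(1+\frac{\pi+\pi^2}{16}\Big)^4}\Bigg)\Bigg(1+\frac{3^5(67-44\sqrt2)}{2^{34}\cdot5\cdot7\,j_0}\,\mathfrak{c}_1\Bigg)^{-1},$$ where $$\Phi_{1,\infty}(\Omega)=\frac{1}{|\Omega|}\frac{\|w_{\Omega}\|_1}{\|w_{\Omega}\|_{\infty}},\qquad \mathfrak{c}_1=\max_{c\ge\frac92\log 2}\frac{(1-2^{9/2}e^{-c})^7}{c^9},$$ and $j_0$ is the first positive zero of the Bessel function $J_0$.
   Context: For a non-empty open set $\Omega\subset\mathbb{R}^2$ of finite Lebesgue measure $|\Omega|$, $w_\Omega$ is the torsion function, i.e. the unique weak solution of $-\Delta w=1$, $w\in H^1_0(\Omega)$; $\|\cdot\|_p$ is the $L^p(\Omega)$ norm. $\Phi_{1,\infty}(\Omega)$ is called the mean to max ratio of the torsion function. *)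

theory Defs
  imports "HOL-Probability.Essential_Supremum"
begin

primrec C_k :: "nat \<Rightarrow> ('a::euclidean_space \<Rightarrow> real) \<Rightarrow> bool" where
  "C_k 0 f \<longleftrightarrow> continuous_on UNIV f"
| "C_k (Suc k) f \<longleftrightarrow> f differentiable_on UNIV \<and>
     (\<forall>b\<in>Basis. C_k k (\<lambda>x. frechet_derivative f (at x) b))"

(* C_c^infinity(\<Omega>); a test function is defined on the whole space and vanishes off its support. *)
definition test_function :: "'a::euclidean_space set \<Rightarrow> ('a \<Rightarrow> real) \<Rightarrow> bool" where
  "test_function \<Omega> \<phi> \<longleftrightarrow> (\<forall>k. C_k k \<phi>) \<and>
     compact (closure {x. \<phi> x \<noteq> 0}) \<and> closure {x. \<phi> x \<noteq> 0} \<subseteq> \<Omega>"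

definition grad :: "('a::euclidean_space \<Rightarrow> real) \<Rightarrow> 'a \<Rightarrow> 'a" where
  "grad f x = (\<Sum>b\<in>Basis. frechet_derivative f (at x) b *\<^sub>R b)"

definition in_L2 :: "'a::euclidean_space set \<Rightarrow> ('a \<Rightarrow> 'b::euclidean_space) \<Rightarrow> bool" where
  "in_L2 \<Omega> f \<longleftrightarrow> f \<in> borel_measurable (lebesgue_on \<Omega>) \<and>
     integrable (lebesgue_on \<Omega>) (\<lambda>x. (norm (f x))\<^sup>2)"

(* Functions in L^2 and H^1 are represented by arbitrary pointwise representatives, and a
   Sobolev function u is carried together with a representative g of its weak gradient. *)
definition has_weak_gradient ::
    "'a::euclidean_space set \<Rightarrow> ('a \<Rightarrow> real) \<Rightarrow> ('a \<Rightarrow> 'a) \<Rightarrow> bool" where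
  "has_weak_gradient \<Omega> u g \<longleftrightarrow> (\<forall>\<phi>. test_function \<Omega> \<phi> \<longrightarrow>
     (LINT x|lebesgue_on \<Omega>. u x *\<^sub>R grad \<phi> x) = - (LINT x|lebesgue_on \<Omega>. \<phi> x *\<^sub>R g x))"

definition in_H1 :: "'a::euclidean_space set \<Rightarrow> ('a \<Rightarrow> real) \<Rightarrow> ('a \<Rightarrow> 'a) \<Rightarrow> bool" where
  "in_H1 \<Omega> u g \<longleftrightarrow> in_L2 \<Omega> u \<and> in_L2 \<Omega> g \<and> has_weak_gradient \<Omega> u g"

(* H^1_0(\<Omega>) is the closure of C_c^infinity(\<Omega>) in the H^1 norm. *)
definition in_H10 :: "'a::euclidean_space set \<Rightarrow> ('a \<Rightarrow> real) \<Rightarrow> ('a \<Rightarrow> 'a) \<Rightarrow> bool" where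
  "in_H10 \<Omega> u g \<longleftrightarrow> in_H1 \<Omega> u g \<and>
     (\<exists>\<phi>. (\<forall>n::nat. test_function \<Omega> (\<phi> n)) \<and>
        (\<lambda>n. (LINT x|lebesgue_on \<Omega>. (\<phi> n x - u x)\<^sup>2) +
             (LINT x|lebesgue_on \<Omega>. (norm (grad (\<phi> n) x - g x))\<^sup>2)) \<longlonglongrightarrow> 0)"

definition is_torsion_function :: "'a::euclidean_space set \<Rightarrow> ('a \<Rightarrow> real) \<Rightarrow> bool" where
  "is_torsion_function \<Omega> w \<longleftrightarrow> (\<exists>g. in_H10 \<Omega> w g \<and>
     (\<forall>v h. in_H10 \<Omega> v h \<longrightarrow>
        (LINT x|lebesgue_on \<Omega>. g x \<bullet> h x) = (LINT x|lebesgue_on \<Omega>. v x)))"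

(* The torsion function is unique only up to null sets, which is why SOME rather than THE
   selects a representative; the norms below do not depend on the choice. *)
definition torsion_function :: "'a::euclidean_space set \<Rightarrow> 'a \<Rightarrow> real" where
  "torsion_function \<Omega> = (SOME w. is_torsion_function \<Omega> w)"

definition L1_norm :: "'a::euclidean_space set \<Rightarrow> ('a \<Rightarrow> real) \<Rightarrow> real" where
  "L1_norm \<Omega> f = (LINT x|lebesgue_on \<Omega>. \<bar>f x\<bar>)"

definition Linf_norm :: "'a::euclidean_space set \<Rightarrow> ('a \<Rightarrow> real) \<Rightarrow> real" where
  "Linf_norm \<Omega> f = real_of_ereal (esssup (lebesgue_on \<Omega>) (\<lambda>x. ereal \<bar>f x\<bar>))"

definition mean_to_max :: "'a::euclidean_space set \<Rightarrow> real" where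
  "mean_to_max \<Omega> = 1 / measure lebesgue \<Omega> *
     (L1_norm \<Omega> (torsion_function \<Omega>) / Linf_norm \<Omega> (torsion_function \<Omega>))"

definition Bessel_J0 :: "real \<Rightarrow> real" where
  "Bessel_J0 x = (\<Sum>k. (- 1) ^ k / (fact k)\<^sup>2 * (x / 2) ^ (2 * k))"

definition j0 :: real where
  "j0 = (LEAST x. 0 < x \<and> Bessel_J0 x = 0)"

(* GREATEST (rather than Max, which is for finite sets) expresses an attained maximum. *)
definition c1 :: real where
  "c1 = (GREATEST y. \<exists>c \<ge> 9 / 2 * ln 2. y = (1 - 2 powr (9 / 2) * exp (- c)) ^ 7 / c ^ 9)"

end

(*
  Let w be the torsion function, M its maximum, and call a square any closed axis-parallel one.

  Scale: testing the equation with a bump function supported in a square of side L contained in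
  Omega gives  L^2 / C <= int phi = - int w Laplace(phi) <= 160 M,  so Omega contains no square of
  side sqrt(C M).

  Topology: Omega being simply connected, the boundary of every square of that side then meets the
  complement of Omega, as otherwise the boundary would wind around a point outside Omega.  Hence for
  u vanishing off Omega and every x, the square with x as a corner has a zero of u on its boundary,
  so |u x| is at most the integral of the tangential derivative over the boundary.  Integrating over
  x gives  int |u| <= 2 L int (|d_1 u| + |d_2 u|).

  Conclusion: apply this to u = (sin (a w))^2 with a = pi / (2 M).  If w were close to M in the mean,
  then u would be close to 1 while u' = a sin (2 a w) w' would be small, since int |w'|^2 = int w.
  The resulting gap of 10^-11 between the mean and the maximum exceeds the one claimed.
  The same Poincare inequality also yields the existence of w by the direct method.
*)

theory Submission
  imports Defs "HOL-Complex_Analysis.Complex_Analysis"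
begin

section \<open>Square-integrable functions\<close>

text \<open>The squared sine combines three properties: it vanishes at 0, so \<open>u\<close>
  inherits the zeros of \<open>w\<close>; it equals 1 at height \<open>M\<close>; and its slope
  vanishes there. The last one is decisive. The energy is known only to be at most \<open>M\<close>
  times the area, so Young's inequality must give it a small weight and the slope a large one, and
  this is affordable only if the slope term is small when \<open>w\<close> is close to
  \<open>M\<close>.

  The obstacle is that \<open>w\<close> lies merely in H^1_0 and has no values on the boundary of a
  square. The Poincare inequality is therefore proved for compactly supported C^1 functions and
  applied to the squared sines of approximating test functions; only integrals are carried over to
  \<open>w\<close>, at the price of some factors 2.

  Cosine is even, so the estimates see only |w| and the sign of \<open>w\<close> never has to be
  determined.

  The claimed bound lies within 5 * 10^-12 of 1, which leaves room for crude constants everywhere: 3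
  for e, 2 for pi/2, 1 for the Bessel zero.\<close>

definition L2 :: "'a measure \<Rightarrow> ('a \<Rightarrow> 'b::euclidean_space) \<Rightarrow> bool" where
  "L2 M f \<longleftrightarrow> f \<in> borel_measurable M \<and> integrable M (\<lambda>x. (norm (f x))\<^sup>2)"

lemma in_L2_iff: "in_L2 \<Omega> f \<longleftrightarrow> L2 (lebesgue_on \<Omega>) f"
  by (simp add: in_L2_def L2_def)

lemma L2_measurable[measurable_dest]: "L2 M f \<Longrightarrow> f \<in> borel_measurable M"
  by (simp add: L2_def)

lemma L2_integrable_square: "L2 M f \<Longrightarrow> integrable M (\<lambda>x. (norm (f x))\<^sup>2)"
  by (simp add: L2_def)

lemma L2_integrable_inner:
  assumes f: "L2 M f" and g: "L2 M g"
  shows "integrable M (\<lambda>x. f x \<bullet> g x)"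
proof (rule Bochner_Integration.integrable_bound)
  show "integrable M (\<lambda>x. (norm (f x))\<^sup>2 + (norm (g x))\<^sup>2)"
    using assms by (simp add: L2_integrable_square)
  show "(\<lambda>x. f x \<bullet> g x) \<in> borel_measurable M"
    using assms[THEN L2_measurable] by measurable
  have "\<bar>f x \<bullet> g x\<bar> \<le> (norm (f x))\<^sup>2 + (norm (g x))\<^sup>2" for x
  proof -
    have "\<bar>f x \<bullet> g x\<bar> \<le> norm (f x) * norm (g x)" by (rule Cauchy_Schwarz_ineq2)
    also have "\<dots> \<le> (norm (f x))\<^sup>2 + (norm (g x))\<^sup>2"
      using sum_squares_bound[of "norm (f x)" "norm (g x)"] mult_nonneg_nonneg[OF norm_ge_zero norm_ge_zero, of "f x" "g x"]
      by linarith
    finally show ?thesis .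
  qed
  then show "AE x in M. norm (f x \<bullet> g x) \<le> norm ((norm (f x))\<^sup>2 + (norm (g x))\<^sup>2)"
    by auto
qed

lemma L2_add:
  assumes f: "L2 M f" and g: "L2 M g"
  shows "L2 M (\<lambda>x. f x + g x)"
  unfolding L2_def
proof
  show "(\<lambda>x. f x + g x) \<in> borel_measurable M"
    using assms[THEN L2_measurable] by measurable
  have "(norm (f x + g x))\<^sup>2 = (norm (f x))\<^sup>2 + 2 * (f x \<bullet> g x) + (norm (g x))\<^sup>2" for x
    by (simp add: power2_norm_eq_inner inner_add_left inner_add_right inner_commute)
  then show "integrable M (\<lambda>x. (norm (f x + g x))\<^sup>2)"
    using assms by (simp add: L2_integrable_square L2_integrable_inner)
qed

lemma L2_scaleR: "L2 M f \<Longrightarrow> L2 M (\<lambda>x. c *\<^sub>R f x)"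
  by (auto simp: L2_def power_mult_distrib)

lemma L2_diff:
  assumes "L2 M f" "L2 M g"
  shows "L2 M (\<lambda>x. f x - g x)"
  using L2_add[OF assms(1) L2_scaleR[OF assms(2), of "-1"]] by simp

lemma L2_const: "emeasure M (space M) < \<infinity> \<Longrightarrow> L2 M (\<lambda>x. c)"
  by (auto simp: L2_def finite_measure.integrable_const finite_measureI)

lemma L2_integral_square_add:
  assumes "L2 M f" "L2 M g"
  shows "(LINT x|M. (norm (f x + t *\<^sub>R g x))\<^sup>2)
    = (LINT x|M. (norm (f x))\<^sup>2) + 2 * t * (LINT x|M. f x \<bullet> g x) + t\<^sup>2 * (LINT x|M. (norm (g x))\<^sup>2)"
proof -
  have "(norm (f x + t *\<^sub>R g x))\<^sup>2 = (norm (f x))\<^sup>2 + 2 * t * (f x \<bullet> g x) + t\<^sup>2 * (norm (g x))\<^sup>2" for x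
    unfolding power2_norm_eq_inner
    by (simp add: inner_add_left inner_add_right inner_commute power2_eq_square algebra_simps)
  then show ?thesis
    using assms by (simp add: L2_integrable_square L2_integrable_inner)
qed

text \<open>Evaluate at the vertex \<open>t = - B / C\<close>; for \<open>C = 0\<close> a nonzero
  slope would make an affine function negative. Besides Cauchy-Schwarz this later yields the
  Euler-Lagrange equation, with \<open>A\<close> the excess energy of an almost minimiser.\<close>

lemma quadratic_nonneg_discriminant:
  fixes A B C :: real
  assumes q: "\<And>t. 0 \<le> A + 2 * t * B + t\<^sup>2 * C" and "0 \<le> C"
  shows "B\<^sup>2 \<le> A * C"
proof (cases "C = 0")
  case True
  have "B = 0"
  proof (rule ccontr)
    assume "B \<noteq> 0"
    then have "A + 2 * (- (A + 1) / (2 * B)) * B = - 1" by (simp add: field_simps)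
    then show False using q[of "- (A + 1) / (2 * B)"] True by simp
  qed
  then show ?thesis using True by simp
next
  case False
  then have "C > 0" using assms(2) by simp
  have "0 \<le> (A + 2 * (- B / C) * B + (- B / C)\<^sup>2 * C) * C"
    by (intro mult_nonneg_nonneg q assms(2))
  also have "\<dots> = A * C - B\<^sup>2"
    using \<open>C > 0\<close> by (simp add: field_simps power2_eq_square)
  finally show ?thesis by simp
qed

lemma L2_Cauchy_Schwarz:
  assumes "L2 M f" "L2 M g"
  shows "(LINT x|M. f x \<bullet> g x)\<^sup>2 \<le> (LINT x|M. (norm (f x))\<^sup>2) * (LINT x|M. (norm (g x))\<^sup>2)"
proof (rule quadratic_nonneg_discriminant)
  fix t :: real
  have "0 \<le> (LINT x|M. (norm (f x + t *\<^sub>R g x))\<^sup>2)" by simp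
  then show "0 \<le> (LINT x|M. (norm (f x))\<^sup>2) + 2 * t * (LINT x|M. f x \<bullet> g x) + t\<^sup>2 * (LINT x|M. (norm (g x))\<^sup>2)"
    by (simp add: L2_integral_square_add[OF assms])
qed simp

lemma tendsto_zero_if_square_le:
  fixes a b :: "nat \<Rightarrow> real"
  assumes "\<And>n. (a n)\<^sup>2 \<le> b n" "b \<longlonglongrightarrow> 0"
  shows "a \<longlonglongrightarrow> 0"
proof -
  have "(\<lambda>n. (a n)\<^sup>2) \<longlonglongrightarrow> 0"
    by (rule tendsto_sandwich[OF always_eventually always_eventually tendsto_const assms(2)])
      (use assms(1) in auto)
  then have "(\<lambda>n. sqrt ((a n)\<^sup>2)) \<longlonglongrightarrow> sqrt 0" by (rule tendsto_real_sqrt)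
  then show ?thesis by (simp add: tendsto_rabs_zero_iff)
qed

text \<open>Cauchy-Schwarz applied to the difference. Weak identities for limits of test functions
  are obtained through this scalar form.\<close>

lemma L2_tendsto_inner:
  fixes f :: "'a \<Rightarrow> 'b::euclidean_space" and fn :: "nat \<Rightarrow> 'a \<Rightarrow> 'b"
  assumes fn: "\<And>n. L2 M (fn n)" and f: "L2 M f" and h: "L2 M h"
    and lim: "(\<lambda>n. LINT x|M. (norm (fn n x - f x))\<^sup>2) \<longlonglongrightarrow> 0"
  shows "(\<lambda>n. LINT x|M. fn n x \<bullet> h x) \<longlonglongrightarrow> (LINT x|M. f x \<bullet> h x)"
proof -
  let ?H = "LINT x|M. (norm (h x))\<^sup>2"
  have eq: "(LINT x|M. fn n x \<bullet> h x) - (LINT x|M. f x \<bullet> h x) = (LINT x|M. (fn n x - f x) \<bullet> h x)" for n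
    using fn f h by (simp add: inner_diff_left L2_integrable_inner)
  have "(\<lambda>n. (LINT x|M. (norm (fn n x - f x))\<^sup>2) * ?H) \<longlonglongrightarrow> 0"
    using tendsto_mult_right[OF lim, of ?H] by simp
  then have "(\<lambda>n. (LINT x|M. fn n x \<bullet> h x) - (LINT x|M. f x \<bullet> h x)) \<longlonglongrightarrow> 0"
    by (rule tendsto_zero_if_square_le[rotated]) (unfold eq, intro L2_Cauchy_Schwarz L2_diff fn f h)
  then show ?thesis by (simp add: LIM_zero_iff)
qed

lemma power2_norm_add_le: "(norm (a + b :: 'b::real_inner))\<^sup>2 \<le> 2 * (norm a)\<^sup>2 + 2 * (norm b)\<^sup>2"
proof -
  have "(norm (a + b))\<^sup>2 + (norm (a - b))\<^sup>2 = 2 * (norm a)\<^sup>2 + 2 * (norm b)\<^sup>2"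
    by (simp add: power2_norm_eq_inner inner_add_left inner_add_right inner_diff_left inner_diff_right)
  then show ?thesis by (smt (verit) zero_le_power2)
qed

text \<open>Riesz-Fischer: along indices with geometrically small increments, the increments are
  summable in L^1 because the measure is finite, hence summable almost everywhere. Fatou's lemma
  then bounds the distance to the pointwise limit for every late \<open>f n\<close>, not only along
  those indices.\<close>

lemma L2_complete:
  fixes f :: "nat \<Rightarrow> 'a \<Rightarrow> 'b::euclidean_space"
  assumes fin: "emeasure M (space M) < \<infinity>" and f: "\<And>n. L2 M (f n)"
    and cauchy: "\<And>e. 0 < e \<Longrightarrow> \<exists>N. \<forall>m\<ge>N. \<forall>n\<ge>N. (LINT x|M. (norm (f m x - f n x))\<^sup>2) < e"
  obtains g where "L2 M g" "(\<lambda>n. LINT x|M. (norm (f n x - g x))\<^sup>2) \<longlonglongrightarrow> 0"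
proof -
  interpret finite_measure M using fin by (intro finite_measureI) auto
  have [measurable]: "f n \<in> borel_measurable M" for n using f by (rule L2_measurable)
  define \<mu> where "\<mu> = measure M (space M)"
  have "\<exists>N. \<forall>m\<ge>N. \<forall>n\<ge>N. (LINT x|M. (norm (f m x - f n x))\<^sup>2) < (1/4)^k" for k
    by (rule cauchy) simp
  then obtain N where N: "\<And>k m n. m \<ge> N k \<Longrightarrow> n \<ge> N k \<Longrightarrow> (LINT x|M. (norm (f m x - f n x))\<^sup>2) < (1/4)^k"
    by metis
  \<comment> \<open>Partial sums make \<open>r j\<close> at least \<open>N k\<close> for every
    \<open>j\<close> from \<open>k\<close> on, so \<open>r k\<close> and \<open>r (Suc k)\<close>
    are both late enough for the bound at level \<open>k\<close>.\<close>
  define r where "r = (\<lambda>k. \<Sum>i\<le>k. N i)"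
  have rN: "N k \<le> r k" for k unfolding r_def by (simp add: member_le_sum)
  have rS: "N k \<le> r (Suc k)" for k using rN[of k] by (simp add: r_def)
  define d where "d k x = norm (f (r (Suc k)) x - f (r k) x)" for k x
  have d2: "L2 M (d k)" for k
    using L2_diff[OF f f, of "r (Suc k)" "r k"] unfolding d_def L2_def by simp
  have [measurable]: "d k \<in> borel_measurable M" for k using d2 by (rule L2_measurable)
  have di: "integrable M (d k)" for k
    using L2_integrable_inner[OF d2 L2_const[OF fin, of 1]] by simp
  have dint: "(LINT x|M. d k x) \<le> sqrt \<mu> * (1/2)^k" for k
  proof -
    have "(LINT x|M. d k x)\<^sup>2 \<le> (LINT x|M. (norm (d k x))\<^sup>2) * (LINT x|M. (norm (1::real))\<^sup>2)"
      using L2_Cauchy_Schwarz[OF d2 L2_const[OF fin, of "1::real"]] by simp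
    also have "\<dots> \<le> (1/4)^k * \<mu>"
      using mult_right_mono[OF less_imp_le[OF N[OF rS rN, of k]], of \<mu>] by (simp add: d_def \<mu>_def)
    also have "\<dots> = (sqrt \<mu> * (1/2)^k)\<^sup>2"
      by (simp add: power_mult_distrib \<mu>_def power_mult[symmetric] mult.commute[of k 2])
         (simp add: power_mult power_divide)
    finally show ?thesis by (rule power2_le_imp_le) (simp add: \<mu>_def)
  qed
  have "(\<integral>\<^sup>+ x. (\<Sum>k. ennreal (d k x)) \<partial>M) = (\<Sum>k. \<integral>\<^sup>+ x. ennreal (d k x) \<partial>M)"
    by (intro nn_integral_suminf) measurable
  also have "\<dots> = (\<Sum>k. ennreal (LINT x|M. d k x))"
    by (intro suminf_cong nn_integral_eq_integral di) (simp add: d_def)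
  also have "\<dots> \<le> (\<Sum>k. ennreal (sqrt \<mu> * (1/2)^k))"
    by (intro suminf_le ennreal_leI dint) auto
  also have "\<dots> < \<infinity>"
  proof -
    have "summable (\<lambda>k. sqrt \<mu> * (1/2::real)^k)" by (intro summable_mult summable_geometric) simp
    then have "(\<Sum>k. ennreal (sqrt \<mu> * (1/2)^k)) = ennreal (\<Sum>k. sqrt \<mu> * (1/2)^k)"
      by (intro suminf_ennreal2) (auto simp: \<mu>_def)
    then show ?thesis by simp
  qed
  finally have "(\<integral>\<^sup>+ x. (\<Sum>k. ennreal (d k x)) \<partial>M) \<noteq> \<infinity>" by simp
  then have "AE x in M. (\<Sum>k. ennreal (d k x)) \<noteq> \<infinity>"
    by (intro nn_integral_noteq_infinite) measurable
  then have conv: "AE x in M. convergent (\<lambda>k. f (r k) x)"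
  proof eventually_elim
    fix x assume "(\<Sum>k. ennreal (d k x)) \<noteq> \<infinity>"
    then have "summable (\<lambda>k. d k x)"
      by (intro summable_suminf_not_top) (auto simp: d_def)
    then have "summable (\<lambda>k. f (r (Suc k)) x - f (r k) x)"
      unfolding d_def by (rule summable_norm_cancel)
    then have "convergent (\<lambda>n. \<Sum>k<n. f (r (Suc k)) x - f (r k) x)"
      by (simp add: summable_iff_convergent)
    then have "convergent (\<lambda>n. f (r n) x - f (r 0) x)"
      using sum_lessThan_telescope[of "\<lambda>n. f (r n) x"] by simp
    then have "convergent (\<lambda>n. (f (r n) x - f (r 0) x) + f (r 0) x)"
      by (intro convergent_add convergent_const)
    then show "convergent (\<lambda>k. f (r k) x)" by simp
  qed
  define g where "g x = lim (\<lambda>k. f (r k) x)" for x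
  have gm[measurable]: "g \<in> borel_measurable M" unfolding g_def by measurable
  have glim: "AE x in M. (\<lambda>k. f (r k) x) \<longlonglongrightarrow> g x"
    using conv by eventually_elim (simp add: g_def convergent_LIMSEQ_iff)
  have bound: "(\<integral>\<^sup>+ x. ennreal ((norm (f n x - g x))\<^sup>2) \<partial>M) \<le> ennreal ((1/4)^k)" if n: "n \<ge> N k" for n k
  proof -
    have "(\<integral>\<^sup>+ x. ennreal ((norm (f n x - g x))\<^sup>2) \<partial>M)
      = (\<integral>\<^sup>+ x. liminf (\<lambda>j. ennreal ((norm (f n x - f (r j) x))\<^sup>2)) \<partial>M)"
    proof (intro nn_integral_cong_AE)
      show "AE x in M. ennreal ((norm (f n x - g x))\<^sup>2) = liminf (\<lambda>j. ennreal ((norm (f n x - f (r j) x))\<^sup>2))"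
        using glim
      proof eventually_elim
        fix x assume "(\<lambda>k. f (r k) x) \<longlonglongrightarrow> g x"
        then have "(\<lambda>j. ennreal ((norm (f n x - f (r j) x))\<^sup>2)) \<longlonglongrightarrow> ennreal ((norm (f n x - g x))\<^sup>2)"
          by (intro tendsto_intros)
        then show "ennreal ((norm (f n x - g x))\<^sup>2) = liminf (\<lambda>j. ennreal ((norm (f n x - f (r j) x))\<^sup>2))"
          by (intro lim_imp_Liminf[symmetric]) auto
      qed
    qed
    also have "\<dots> \<le> liminf (\<lambda>j. \<integral>\<^sup>+ x. ennreal ((norm (f n x - f (r j) x))\<^sup>2) \<partial>M)"
      by (rule nn_integral_liminf) measurable
    also have "\<dots> \<le> limsup (\<lambda>j. \<integral>\<^sup>+ x. ennreal ((norm (f n x - f (r j) x))\<^sup>2) \<partial>M)"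
      by (rule Liminf_le_Limsup) simp
    also have "\<dots> \<le> ennreal ((1/4)^k)"
    proof (rule Limsup_bounded)
      show "\<forall>\<^sub>F j in sequentially. (\<integral>\<^sup>+ x. ennreal ((norm (f n x - f (r j) x))\<^sup>2) \<partial>M) \<le> ennreal ((1/4)^k)"
        using eventually_ge_at_top[of k]
      proof eventually_elim
        fix j assume "k \<le> j"
        have "N k \<le> r j" using rN[of k] \<open>k \<le> j\<close> unfolding r_def
          by (meson atMost_subset_iff finite_atMost le0 order_trans sum_mono2)
        have "(\<integral>\<^sup>+ x. ennreal ((norm (f n x - f (r j) x))\<^sup>2) \<partial>M) = ennreal (LINT x|M. (norm (f n x - f (r j) x))\<^sup>2)"
          by (intro nn_integral_eq_integral L2_integrable_square L2_diff f) auto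
        then show "(\<integral>\<^sup>+ x. ennreal ((norm (f n x - f (r j) x))\<^sup>2) \<partial>M) \<le> ennreal ((1/4)^k)"
          using N[OF n \<open>N k \<le> r j\<close>] by (simp add: ennreal_leI less_imp_le)
      qed
    qed
    finally show ?thesis .
  qed
  have diffL2: "L2 M (\<lambda>x. f n x - g x)" if "n \<ge> N k" for n k
    unfolding L2_def
    using bound[OF that] by (auto simp: integrable_iff_bounded intro: le_less_trans)
  \<comment> \<open>\<open>g\<close> is recovered as a member of the sequence minus an error already
    known to be square integrable.\<close>
  have "L2 M (\<lambda>x. f (N 0) x - (f (N 0) x - g x))"
    by (intro L2_diff f diffL2[of 0]) simp
  then have g: "L2 M g" by simp
  have "(\<lambda>n. LINT x|M. (norm (f n x - g x))\<^sup>2) \<longlonglongrightarrow> 0"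
  proof (rule LIMSEQ_I)
    fix e :: real assume "0 < e"
    then obtain k where k: "(1/4::real)^k < e" using real_arch_pow_inv[of e "1/4"] by auto
    have "norm ((LINT x|M. (norm (f n x - g x))\<^sup>2) - 0) < e" if "n \<ge> N k" for n
    proof -
      have "ennreal (LINT x|M. (norm (f n x - g x))\<^sup>2) \<le> ennreal ((1/4)^k)"
        using bound[OF that] L2_integrable_square[OF diffL2[OF that]] by (subst (asm) nn_integral_eq_integral) auto
      then show ?thesis using k by simp
    qed
    then show "\<exists>no. \<forall>n\<ge>no. norm ((LINT x|M. (norm (f n x - g x))\<^sup>2) - 0) < e" by blast
  qed
  with g show ?thesis by (rule that)
qed

section \<open>A Poincare inequality in simply connected domains\<close>

abbreviation partial :: "'a::euclidean_space \<Rightarrow> ('a \<Rightarrow> real) \<Rightarrow> 'a \<Rightarrow> real" where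
  "partial b f x \<equiv> frechet_derivative f (at x) b"

lemma C_1_differentiable: "C_k 1 u \<Longrightarrow> u differentiable at x"
  by (simp add: differentiable_on_def)

lemma C_1_continuous_partial: "C_k 1 u \<Longrightarrow> b \<in> Basis \<Longrightarrow> continuous_on UNIV (partial b u)"
  by simp

lemma C_1_continuous: "C_k 1 u \<Longrightarrow> continuous_on UNIV u"
  by (simp add: differentiable_imp_continuous_on)

lemma simply_connected_square_boundary:
  fixes \<Omega> :: "(real^2) set" and p q :: "real^2"
  assumes "simply_connected \<Omega>" and nsub: "\<not> cbox p q \<subseteq> \<Omega>"
  obtains z where "z \<in> cbox p q" "z \<notin> box p q" "z \<notin> \<Omega>"
proof (cases "cbox p q - box p q \<subseteq> \<Omega>")
  case False
  then show ?thesis using that by blast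
next
  case True
  \<comment> \<open>Winding numbers live in the complex plane, so the domain and the square are
    carried there by a linear isomorphism, which preserves simple connectivity.\<close>
  define f :: "real^2 \<Rightarrow> complex" where "f x = Complex (x$1) (x$2)" for x
  have inj: "inj f"
    by (auto simp: f_def inj_on_def vec_eq_iff forall_2)
  have lin: "linear f"
    by (auto simp: f_def linear_iff complex_eq_iff)
  have "\<Omega> homeomorphic f ` \<Omega>"
    using linear_homeomorphic_image[OF lin inj] .
  then have sc: "simply_connected (f ` \<Omega>)"
    using assms(1) homeomorphic_simply_connected by blast
  from nsub True obtain z where z: "z \<in> box p q" "z \<notin> \<Omega>" by blast
  have bz: "f z \<in> box (f p) (f q)"
    using z(1) by (auto simp: f_def in_box_complex_iff mem_box_cart forall_2)
  have "path_image (rectpath (f p) (f q)) \<subseteq> f ` \<Omega>"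
  proof
    fix w assume w: "w \<in> path_image (rectpath (f p) (f q))"
    define v :: "real^2" where "v = vector [Re w, Im w]"
    have fv: "f v = w" by (simp add: f_def v_def complex_eq_iff)
    have "Re (f p) \<le> Re (f q)" "Im (f p) \<le> Im (f q)"
      using bz by (auto simp: in_box_complex_iff)
    then have "w \<in> cbox (f p) (f q) - box (f p) (f q)"
      using w path_image_rectpath_cbox_minus_box by blast
    then have "v \<in> cbox p q - box p q"
      by (auto simp: fv[symmetric] f_def in_box_complex_iff in_cbox_complex_iff mem_box_cart forall_2)
    then show "w \<in> f ` \<Omega>" using True fv by blast
  qed
  moreover have "f z \<notin> f ` \<Omega>" using z(2) inj by (auto dest: injD)
  ultimately have "winding_number (rectpath (f p) (f q)) (f z) = 0"
    using simply_connected_imp_winding_number_zero[OF sc] by simp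
  then show ?thesis using winding_number_rectpath[OF bz] by simp
qed

lemma has_real_derivative_along_line:
  assumes "u differentiable at (x + r *\<^sub>R b)"
  shows "((\<lambda>r. u (x + r *\<^sub>R b)) has_real_derivative partial b u (x + r *\<^sub>R b)) (at r)"
proof -
  let ?D = "frechet_derivative u (at (x + r *\<^sub>R b))"
  have D: "(u has_derivative ?D) (at (x + r *\<^sub>R b))"
    using assms by (simp add: frechet_derivative_works)
  have "((\<lambda>r. x + r *\<^sub>R b) has_derivative (\<lambda>h. h *\<^sub>R b)) (at r)"
    by (auto intro!: derivative_eq_intros)
  from has_derivative_compose[OF this D]
  have "((\<lambda>r. u (x + r *\<^sub>R b)) has_derivative (\<lambda>h. ?D (h *\<^sub>R b))) (at r)" .
  moreover have "?D (h *\<^sub>R b) = ?D b * h" for h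
    using has_derivative_linear[OF D] by (simp add: linear_cmul)
  ultimately show ?thesis by (simp add: has_field_derivative_def)
qed

text \<open>The fundamental theorem of calculus on the part between the two points. The bound
  integrates over the whole edge and so does not depend on \<open>s\<close> and \<open>t\<close>:
  the zero on the edge will sit at an unknown position that varies with \<open>x\<close>.\<close>

lemma variation_along_segment:
  fixes u :: "'a::euclidean_space \<Rightarrow> real"
  assumes u: "C_k 1 u" and b: "b \<in> Basis" and "0 \<le> s" "s \<le> L" "0 \<le> t" "t \<le> L"
  shows "ennreal \<bar>u (x + t *\<^sub>R b) - u (x + s *\<^sub>R b)\<bar>
    \<le> (\<integral>\<^sup>+ r. ennreal \<bar>partial b u (x + r *\<^sub>R b)\<bar> * indicator {0..L} r \<partial>lborel)"
  using assms(3-)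
proof (induction s t rule: linorder_wlog)
  case (sym s t)
  then show ?case by (simp add: abs_minus_commute)
next
  case (le s t)
  let ?F = "\<lambda>r. u (x + r *\<^sub>R b)" and ?f = "\<lambda>r. partial b u (x + r *\<^sub>R b)"
  have d: "(?F has_real_derivative ?f r) (at r)" for r
    by (intro has_real_derivative_along_line C_1_differentiable u)
  have c: "isCont ?f r" for r
  proof -
    have "continuous_on UNIV (\<lambda>r. partial b u (x + r *\<^sub>R b))"
      by (rule continuous_on_compose2[OF C_1_continuous_partial[OF u b]])
        (auto intro!: continuous_intros)
    then show ?thesis by (simp add: continuous_on_eq_continuous_at)
  qed
  have hb: "has_bochner_integral lborel (\<lambda>r. ?f r * indicator {s..t} r) (?F t - ?F s)"
    by (rule has_bochner_integral_FTC_Icc_real[OF le(1) d c])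
  have "ennreal \<bar>?F t - ?F s\<bar> \<le> (\<integral>\<^sup>+ r. ennreal (norm (?f r * indicator {s..t} r)) \<partial>lborel)"
    using integral_norm_bound_ennreal[of lborel "\<lambda>r. ?f r * indicator {s..t} r"] hb
    by (simp add: has_bochner_integral_iff)
  also have "\<dots> \<le> (\<integral>\<^sup>+ r. ennreal \<bar>?f r\<bar> * indicator {0..L} r \<partial>lborel)"
    using le by (intro nn_integral_mono) (auto simp: indicator_def)
  finally show ?case .
qed

lemma nn_integral_translate_lborel:
  fixes f :: "'a::euclidean_space \<Rightarrow> ennreal"
  assumes "f \<in> borel_measurable borel"
  shows "(\<integral>\<^sup>+ x. f (x + c) \<partial>lborel) = (\<integral>\<^sup>+ x. f x \<partial>lborel)"
proof -
  have "(\<integral>\<^sup>+ x. f x \<partial>lborel) = (\<integral>\<^sup>+ x. f x \<partial>distr lborel borel ((+) c))"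
    by (simp add: lborel_distr_plus)
  also have "\<dots> = (\<integral>\<^sup>+ x. f (c + x) \<partial>lborel)"
    using assms by (intro nn_integral_distr) auto
  finally show ?thesis by (simp add: add.commute)
qed

text \<open>By Tonelli the integral over \<open>x\<close> can be taken first, and translation
  invariance makes it the same for every \<open>r\<close> and every offset \<open>c\<close>. Edges
  in the same direction thus contribute equally.\<close>

lemma nn_integral_segments:
  fixes f :: "'a::euclidean_space \<Rightarrow> real"
  assumes f: "continuous_on UNIV f" and "0 \<le> L"
  shows "(\<integral>\<^sup>+ x. (\<integral>\<^sup>+ r. ennreal \<bar>f (x + c + r *\<^sub>R b)\<bar> * indicator {0..L} r \<partial>lborel) \<partial>lborel)
    = ennreal L * (\<integral>\<^sup>+ x. ennreal \<bar>f x\<bar> \<partial>lborel)"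
proof -
  have fm[measurable]: "f \<in> borel_measurable borel" using f by (rule borel_measurable_continuous_onI)
  have "(\<integral>\<^sup>+ x. (\<integral>\<^sup>+ r. ennreal \<bar>f (x + c + r *\<^sub>R b)\<bar> * indicator {0..L} r \<partial>lborel) \<partial>lborel)
    = (\<integral>\<^sup>+ r. (\<integral>\<^sup>+ x. ennreal \<bar>f (x + c + r *\<^sub>R b)\<bar> * indicator {0..L} r \<partial>lborel) \<partial>lborel)"
    by (intro lborel_pair.Fubini') measurable
  also have "\<dots> = (\<integral>\<^sup>+ r. (\<integral>\<^sup>+ x. ennreal \<bar>f x\<bar> \<partial>lborel) * indicator {0..L} r \<partial>lborel)"
  proof (intro nn_integral_cong)
    fix r :: real
    have "(\<integral>\<^sup>+ x. ennreal \<bar>f (x + c + r *\<^sub>R b)\<bar> * indicator {0..L} r \<partial>lborel)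
      = (\<integral>\<^sup>+ x. ennreal \<bar>f (x + (c + r *\<^sub>R b))\<bar> \<partial>lborel) * indicator {0..L} r"
      using fm by (subst nn_integral_multc) (auto simp: add.assoc)
    then show "(\<integral>\<^sup>+ x. ennreal \<bar>f (x + c + r *\<^sub>R b)\<bar> * indicator {0..L} r \<partial>lborel)
      = (\<integral>\<^sup>+ x. ennreal \<bar>f x\<bar> \<partial>lborel) * indicator {0..L} r"
      using nn_integral_translate_lborel[of "\<lambda>x. ennreal \<bar>f x\<bar>"] fm by simp
  qed
  also have "\<dots> = ennreal L * (\<integral>\<^sup>+ x. ennreal \<bar>f x\<bar> \<partial>lborel)"
    using assms(2) by (simp add: nn_integral_multc mult.commute)
  finally show ?thesis .
qed

text \<open>Here \<open>1\<close> is the all-ones vector, so the box is the closed square of side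
  \<open>L\<close> with lower left corner \<open>p\<close>.\<close>

definition no_square :: "(real^2) set \<Rightarrow> real \<Rightarrow> bool" where
  "no_square \<Omega> L \<longleftrightarrow> (\<forall>p. \<not> cbox p (p + L *\<^sub>R 1) \<subseteq> \<Omega>)"

text \<open>The zero on the boundary is reached from the corner \<open>x\<close> along one edge or
  two consecutive ones. Since its location depends on \<open>x\<close> in no controlled way, all
  four edge integrals are summed; each direction occurs twice, whence the factor
  \<open>2 * L\<close>.\<close>

lemma poincare_L1:
  fixes u :: "real^2 \<Rightarrow> real"
  assumes u: "C_k 1 u" and u0: "\<And>x. x \<notin> \<Omega> \<Longrightarrow> u x = 0"
    and sc: "simply_connected \<Omega>" and ns: "no_square \<Omega> L" and L: "0 \<le> L"
  shows "(\<integral>\<^sup>+ x. ennreal \<bar>u x\<bar> \<partial>lborel) \<le> ennreal (2 * L) *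
    (\<integral>\<^sup>+ x. ennreal \<bar>partial (axis 1 1) u x\<bar> + ennreal \<bar>partial (axis 2 1) u x\<bar> \<partial>lborel)"
proof -
  let ?e = "axis 1 1 :: real^2" and ?d = "axis 2 1 :: real^2"
  \<comment> \<open>The variation of \<open>u\<close> along the edge that leaves
    \<open>x + c\<close> in direction \<open>b\<close>.\<close>
  define S where "S b c x = (\<integral>\<^sup>+ r. ennreal \<bar>partial b u (x + c + r *\<^sub>R b)\<bar> * indicator {0..L} r \<partial>lborel)" 
    for b c x :: "real^2"
  have bas: "?e \<in> Basis" "?d \<in> Basis" by (simp_all add: axis_in_Basis_iff)
  have cont: "continuous_on UNIV (partial b u)" if "b \<in> Basis" for b
    by (rule C_1_continuous_partial[OF u that])
  have [measurable]: "partial b u \<in> borel_measurable borel" if "b \<in> Basis" for b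
    using cont[OF that] by (rule borel_measurable_continuous_onI)
  have seg: "ennreal \<bar>u (x + c + t *\<^sub>R b) - u (x + c + s *\<^sub>R b)\<bar> \<le> S b c x"
    if "b \<in> Basis" "0 \<le> s" "s \<le> L" "0 \<le> t" "t \<le> L" for b c x s t
    unfolding S_def using variation_along_segment[OF u that] .
  have tri: "ennreal \<bar>a\<bar> \<le> m + n" if "ennreal \<bar>c\<bar> \<le> n" "ennreal \<bar>a - c\<bar> \<le> m" for a c :: real and m n
  proof -
    have "ennreal \<bar>a\<bar> \<le> ennreal \<bar>a - c\<bar> + ennreal \<bar>c\<bar>"
      by (subst ennreal_plus[symmetric]) (auto intro!: ennreal_leI simp del: ennreal_plus)
    also have "\<dots> \<le> m + n" using that by (intro add_mono)
    finally show ?thesis .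
  qed
  have le4: "a \<le> b1 + b2 + (b3 + b4)"
    if "a \<le> b1 \<or> a \<le> b3 \<or> a \<le> b1 + b2 \<or> a \<le> b3 + b4" for a b1 b2 b3 b4 :: ennreal
    using that by (metis add_increasing add_increasing2 zero_le)
  have pt: "ennreal \<bar>u x\<bar> \<le> S ?e 0 x + S ?d (L *\<^sub>R ?e) x + (S ?d 0 x + S ?e (L *\<^sub>R ?d) x)" for x
  proof -
    from ns obtain z where z: "z \<in> cbox x (x + L *\<^sub>R 1)" "z \<notin> box x (x + L *\<^sub>R 1)" "z \<notin> \<Omega>"
      using simply_connected_square_boundary[OF sc] unfolding no_square_def by metis
    define s t where "s = z$1 - x$1" and "t = z$2 - x$2"
    have st: "0 \<le> s" "s \<le> L" "0 \<le> t" "t \<le> L"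
      using z(1) by (auto simp: s_def t_def mem_box_cart forall_2)
    have zz: "z = x + s *\<^sub>R ?e + t *\<^sub>R ?d"
      by (auto simp: s_def t_def vec_eq_iff forall_2 axis_def)
    have uz: "u z = 0" using u0 z(3) by blast
    have "s = 0 \<or> s = L \<or> t = 0 \<or> t = L"
      using z(2) st by (auto simp: s_def t_def mem_box_cart forall_2)
    \<comment> \<open>The bottom and the left edge start at \<open>x\<close>; the right and the top
      edge are reached by way of the bottom and the left edge respectively.\<close>
    then consider "t = 0" | "s = L" | "s = 0" | "t = L" by blast
    then show ?thesis
    proof cases
      case 1
      have "ennreal \<bar>u x\<bar> \<le> S ?e 0 x"
        using seg[OF bas(1) st(1,2), of 0 x 0] zz uz 1 L by (simp add: add.commute)
      then show ?thesis by (intro le4) blast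
    next
      case 2
      have "ennreal \<bar>u (x + L *\<^sub>R ?e)\<bar> \<le> S ?d (L *\<^sub>R ?e) x"
        using seg[OF bas(2) st(3,4), of 0 x "L *\<^sub>R ?e"] zz uz 2 L by simp
      moreover have "ennreal \<bar>u x - u (x + L *\<^sub>R ?e)\<bar> \<le> S ?e 0 x"
        using seg[OF bas(1), of L 0 x 0] L by simp
      ultimately have "ennreal \<bar>u x\<bar> \<le> S ?e 0 x + S ?d (L *\<^sub>R ?e) x"
        by (rule tri)
      then show ?thesis by (intro le4) blast
    next
      case 3
      have "ennreal \<bar>u x\<bar> \<le> S ?d 0 x"
        using seg[OF bas(2) st(3,4), of 0 x 0] zz uz 3 L by simp
      then show ?thesis by (intro le4) blast
    next
      case 4
      have "ennreal \<bar>u (x + L *\<^sub>R ?d)\<bar> \<le> S ?e (L *\<^sub>R ?d) x"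
        using seg[OF bas(1) st(1,2), of 0 x "L *\<^sub>R ?d"] zz uz 4 L by (simp add: add_ac)
      moreover have "ennreal \<bar>u x - u (x + L *\<^sub>R ?d)\<bar> \<le> S ?d 0 x"
        using seg[OF bas(2), of L 0 x 0] L by simp
      ultimately have "ennreal \<bar>u x\<bar> \<le> S ?d 0 x + S ?e (L *\<^sub>R ?d) x"
        by (rule tri)
      then show ?thesis by (intro le4) blast
    qed
  qed
  have Sm[measurable]: "S b c \<in> borel_measurable lborel" if "b \<in> Basis" for b c
    unfolding S_def using that by measurable
  have SI: "(\<integral>\<^sup>+ x. S b c x \<partial>lborel) = ennreal L * (\<integral>\<^sup>+ x. ennreal \<bar>partial b u x\<bar> \<partial>lborel)"
    if "b \<in> Basis" for b c
    unfolding S_def by (rule nn_integral_segments[OF cont[OF that] L])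
  have "(\<integral>\<^sup>+ x. ennreal \<bar>u x\<bar> \<partial>lborel)
    \<le> (\<integral>\<^sup>+ x. S ?e 0 x + S ?d (L *\<^sub>R ?e) x + (S ?d 0 x + S ?e (L *\<^sub>R ?d) x) \<partial>lborel)"
    by (intro nn_integral_mono pt)
  also have "\<dots> = ennreal L * (\<integral>\<^sup>+ x. ennreal \<bar>partial ?e u x\<bar> \<partial>lborel)
      + ennreal L * (\<integral>\<^sup>+ x. ennreal \<bar>partial ?d u x\<bar> \<partial>lborel)
      + (ennreal L * (\<integral>\<^sup>+ x. ennreal \<bar>partial ?d u x\<bar> \<partial>lborel)
      + ennreal L * (\<integral>\<^sup>+ x. ennreal \<bar>partial ?e u x\<bar> \<partial>lborel))"
    using bas by (simp add: nn_integral_add SI)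
  also have "\<dots> = ennreal (2 * L) *
    (\<integral>\<^sup>+ x. ennreal \<bar>partial ?e u x\<bar> + ennreal \<bar>partial ?d u x\<bar> \<partial>lborel)"
    using bas L by (simp add: nn_integral_add ennreal_mult mult_2 distrib_left distrib_right algebra_simps)
  finally show ?thesis .
qed

section \<open>Test functions\<close>

lemma partial_eqI: "(f has_derivative f') (at x) \<Longrightarrow> partial b f x = f' b"
  using frechet_derivative_at by fastforce

lemma partial_add:
  assumes "f differentiable at x" "g differentiable at x"
  shows "partial b (\<lambda>x. f x + g x) x = partial b f x + partial b g x"
  using has_derivative_add[OF assms[THEN frechet_derivative_works[THEN iffD1]]] by (rule partial_eqI)

lemma partial_mult:
  assumes "f differentiable at x" "g differentiable at x"
  shows "partial b (\<lambda>x. f x * g x) x = f x * partial b g x + partial b f x * g x"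
  using has_derivative_mult[OF assms[THEN frechet_derivative_works[THEN iffD1]]] by (rule partial_eqI)

lemma partial_const: "partial b (\<lambda>x. c) x = 0"
  by (rule partial_eqI) auto

lemma partial_chain:
  assumes "f differentiable at x" "(h has_real_derivative h') (at (f x))"
  shows "partial b (\<lambda>x. h (f x)) x = h' * partial b f x"
    and "(\<lambda>x. h (f x)) differentiable at x"
proof -
  have "((\<lambda>x. h (f x)) has_derivative (\<lambda>y. h' * frechet_derivative f (at x) y)) (at x)"
    using has_derivative_compose[OF assms(1)[THEN frechet_derivative_works[THEN iffD1]], of h "(*) h'"] assms(2)
    by (simp add: has_field_derivative_def)
  then show "partial b (\<lambda>x. h (f x)) x = h' * partial b f x" "(\<lambda>x. h (f x)) differentiable at x"
    by (auto simp: partial_eqI differentiable_def)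
qed

lemma C_k_Suc_D: "C_k (Suc k) f \<Longrightarrow> C_k k f"
  by (induction k arbitrary: f) (auto simp: differentiable_imp_continuous_on)

lemma C_k_SucD1: "C_k (Suc k) f \<Longrightarrow> f differentiable at x"
  by (simp add: differentiable_on_def)

lemma C_k_const: "C_k k (\<lambda>x. c)"
  by (induction k arbitrary: c) (simp_all add: partial_const)

lemma C_k_add: "C_k k f \<Longrightarrow> C_k k g \<Longrightarrow> C_k k (\<lambda>x. f x + g x)"
proof (induction k arbitrary: f g)
  case 0
  then show ?case by (simp add: continuous_on_add)
next
  case (Suc k)
  have "partial b (\<lambda>x. f x + g x) = (\<lambda>x. partial b f x + partial b g x)" for b
    using Suc.prems by (intro ext partial_add C_k_SucD1)
  then show ?case using Suc by (simp add: differentiable_on_add)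
qed

lemma C_k_mult: "C_k k f \<Longrightarrow> C_k k g \<Longrightarrow> C_k k (\<lambda>x. f x * g x)"
proof (induction k arbitrary: f g)
  case 0
  then show ?case by (simp add: continuous_on_mult)
next
  case (Suc k)
  have "partial b (\<lambda>x. f x * g x) = (\<lambda>x. f x * partial b g x + partial b f x * g x)" for b
    using Suc.prems by (intro ext partial_mult C_k_SucD1)
  moreover have "C_k k (\<lambda>x. f x * partial b g x + partial b f x * g x)" if "b \<in> Basis" for b
    using Suc.prems that by (intro C_k_add Suc.IH) (auto dest: C_k_Suc_D simp del: C_k.simps(2), auto)
  ultimately show ?case using Suc.prems by (simp add: differentiable_on_mult)
qed

text \<open>Order one is what the Poincare inequality asks of a composite such as
  \<open>(sin (a * \<phi> x))\<^sup>2\<close>, so no chain rule of higher order has to be set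
  up.\<close>

lemma C_1_chain:
  assumes f: "C_k 1 f" and h: "\<And>t. (h has_real_derivative h' t) (at t)" and c: "continuous_on UNIV h'"
  shows "C_k 1 (\<lambda>x. h (f x))"
proof -
  have "partial b (\<lambda>x. h (f x)) = (\<lambda>x. h' (f x) * partial b f x)" for b
    using partial_chain(1)[OF C_1_differentiable[OF f] h] by blast
  moreover have "continuous_on UNIV (\<lambda>x. h' (f x) * partial b f x)" if "b \<in> Basis" for b
    by (intro continuous_on_mult C_1_continuous_partial[OF f that] continuous_on_compose2[OF c C_1_continuous[OF f]]) auto
  ultimately show ?thesis
    using partial_chain(2)[OF C_1_differentiable[OF f] h] by (simp add: differentiable_on_def)
qed

text \<open>The support is described by some compact \<open>K\<close> instead of the closure of the
  set of nonzeros: unions and larger compact sets can then serve as witnesses, and vector values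
  cover gradients.\<close>

definition Cc :: "'a::euclidean_space set \<Rightarrow> ('a \<Rightarrow> 'b::euclidean_space) \<Rightarrow> bool" where
  "Cc \<Omega> h \<longleftrightarrow> continuous_on UNIV h \<and> (\<exists>K. compact K \<and> K \<subseteq> \<Omega> \<and> (\<forall>x. x \<notin> K \<longrightarrow> h x = 0))"

lemma Cc_continuous: "Cc \<Omega> h \<Longrightarrow> continuous_on UNIV h"
  by (simp add: Cc_def)

lemma Cc_zero: "Cc \<Omega> h \<Longrightarrow> x \<notin> \<Omega> \<Longrightarrow> h x = 0"
  by (auto simp: Cc_def)

lemma Cc_mono: "Cc \<Omega> h \<Longrightarrow> \<Omega> \<subseteq> \<Omega>' \<Longrightarrow> Cc \<Omega>' h"
  unfolding Cc_def by (meson order_trans)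

text \<open>A map fixing 0 does not enlarge the support. \<open>H\<close> may depend on
  \<open>x\<close>, so that multiplication by a continuous function is an instance.\<close>

lemma Cc_comp:
  assumes "Cc \<Omega> h" "continuous_on UNIV h \<Longrightarrow> continuous_on UNIV (\<lambda>x. H x (h x))" "\<And>x. H x 0 = 0"
  shows "Cc \<Omega> (\<lambda>x. H x (h x))"
  using assms unfolding Cc_def by (metis (no_types, lifting))

lemma Cc_add:
  assumes "Cc \<Omega> f" "Cc \<Omega> g"
  shows "Cc \<Omega> (\<lambda>x. f x + g x)"
proof -
  from assms obtain K L where "compact K" "K \<subseteq> \<Omega>" "\<And>x. x \<notin> K \<Longrightarrow> f x = 0" "compact L" "L \<subseteq> \<Omega>" "\<And>x. x \<notin> L \<Longrightarrow> g x = 0"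
    unfolding Cc_def by metis
  then have "compact (K \<union> L)" "K \<union> L \<subseteq> \<Omega>" "\<And>x. x \<notin> K \<union> L \<Longrightarrow> f x + g x = 0"
    by (auto intro: compact_Un)
  then show ?thesis
    using assms unfolding Cc_def by (blast intro: continuous_on_add)
qed

lemma Cc_scaleR_right: "Cc \<Omega> f \<Longrightarrow> Cc \<Omega> (\<lambda>x. c *\<^sub>R f x)"
  by (rule Cc_comp[where H = "\<lambda>x y. c *\<^sub>R y"]) (auto intro!: continuous_intros)

lemma Cc_scaleR_left: "Cc \<Omega> f \<Longrightarrow> Cc \<Omega> (\<lambda>x. f x *\<^sub>R c)"
  by (rule Cc_comp[where H = "\<lambda>x y. y *\<^sub>R c"]) (auto intro!: continuous_intros)

lemma Cc_sum: "(\<And>i. i \<in> I \<Longrightarrow> Cc \<Omega> (f i)) \<Longrightarrow> Cc \<Omega> (\<lambda>x. \<Sum>i\<in>I. f i x)"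
proof (induction I rule: infinite_finite_induct)
  case (insert i I)
  then show ?case by (simp add: Cc_add)
qed (auto simp: Cc_def intro!: exI[of _ "{}"])

lemma Cc_bounded:
  assumes "Cc \<Omega> h"
  obtains B where "0 < B" "\<And>x. norm (h x) \<le> B"
proof -
  from assms obtain K where K: "compact K" "\<And>x. x \<notin> K \<Longrightarrow> h x = 0" "continuous_on UNIV h"
    unfolding Cc_def by metis
  have "bounded (h ` K)"
    using K by (intro compact_imp_bounded compact_continuous_image) (auto intro: continuous_on_subset)
  then obtain B where "0 < B" "\<And>x. x \<in> K \<Longrightarrow> norm (h x) \<le> B"
    unfolding bounded_pos by blast
  then show ?thesis using K(2) by (intro that[of B]) (metis norm_zero less_imp_le)+
qed

lemma Cc_measurable:
  fixes h :: "'a::euclidean_space \<Rightarrow> 'b::euclidean_space"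
  assumes "Cc \<Omega> h"
  shows "h \<in> borel_measurable borel"
  using assms by (intro borel_measurable_continuous_onI) (simp add: Cc_def)

lemma Cc_integrable_lborel:
  assumes "Cc \<Omega> h"
  shows "integrable lborel h"
proof -
  from assms obtain K where K: "compact K" "\<And>x. x \<notin> K \<Longrightarrow> h x = 0" "continuous_on UNIV h"
    unfolding Cc_def by metis
  have "integrable lborel (\<lambda>x. indicator K x *\<^sub>R h x)"
    using K by (intro borel_integrable_compact) (auto intro: continuous_on_subset)
  moreover have "(\<lambda>x. indicator K x *\<^sub>R h x) = h"
    using K by (auto simp: fun_eq_iff indicator_def)
  ultimately show ?thesis by simp
qed

text \<open>The definitions integrate over \<open>lebesgue_on \<Omega>\<close>, whereas Tonelli and
  translation invariance are used for \<open>lborel\<close>; for Borel functions vanishing off the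
  domain the two integrals agree.\<close>

lemma integral_lebesgue_on_eq_lborel:
  fixes h :: "'a::euclidean_space \<Rightarrow> 'b::euclidean_space"
  assumes \<Omega>: "open \<Omega>" and h: "h \<in> borel_measurable borel" and z: "\<And>x. x \<notin> \<Omega> \<Longrightarrow> h x = 0"
  shows "integral\<^sup>L (lebesgue_on \<Omega>) h = integral\<^sup>L lborel h"
    and "integrable (lebesgue_on \<Omega>) h \<longleftrightarrow> integrable lborel h"
proof -
  have i: "(\<lambda>x. indicator \<Omega> x *\<^sub>R h x) = h"
    using z by (auto simp: fun_eq_iff indicator_def)
  have m: "\<Omega> \<inter> space lebesgue \<in> sets lebesgue" using \<Omega> by simp
  have l: "h \<in> lborel \<rightarrow>\<^sub>M borel" using h by simp
  show "integral\<^sup>L (lebesgue_on \<Omega>) h = integral\<^sup>L lborel h"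
    using integral_restrict_space[OF m, of h] i integral_completion[OF l] by simp
  show "integrable (lebesgue_on \<Omega>) h \<longleftrightarrow> integrable lborel h"
    using integrable_restrict_space[OF m, of h] i integrable_completion[OF l] by simp
qed

lemma
  assumes "open \<Omega>" "Cc \<Omega> h"
  shows Cc_integrable: "integrable (lebesgue_on \<Omega>) h"
    and Cc_integral: "integral\<^sup>L (lebesgue_on \<Omega>) h = integral\<^sup>L lborel h"
  using integral_lebesgue_on_eq_lborel[OF assms(1) Cc_measurable[OF assms(2)]] Cc_zero[OF assms(2)]
    Cc_integrable_lborel[OF assms(2)] by simp_all

lemma Cc_L2:
  assumes "open \<Omega>" "Cc \<Omega> h"
  shows "L2 (lebesgue_on \<Omega>) h"
proof -
  have "Cc \<Omega> (\<lambda>x. (norm (h x))\<^sup>2)"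
    using assms(2)
    by (rule Cc_comp[where H = "\<lambda>x y. (norm y)\<^sup>2"]) (auto intro!: continuous_intros)
  moreover have "h \<in> borel_measurable (lebesgue_on \<Omega>)"
    using Cc_integrable[OF assms] by simp
  ultimately show ?thesis
    using assms(1) by (simp add: L2_def Cc_integrable)
qed

lemma partial_zero_outside:
  assumes "closed K" "\<And>x. x \<notin> K \<Longrightarrow> f x = 0" "x \<notin> K"
  shows "partial b f x = 0"
proof -
  have "((\<lambda>x. 0) has_derivative (\<lambda>h. 0)) (at x)" by simp
  then have "(f has_derivative (\<lambda>h. 0)) (at x)"
    by (rule has_derivative_transform_within_open[where s = "- K"]) (use assms in auto)
  then show ?thesis by (rule partial_eqI)
qed

lemma Cc_partial:
  assumes u: "C_k 1 u" and c: "Cc \<Omega> u" and b: "b \<in> Basis"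
  shows "Cc \<Omega> (partial b u)"
proof -
  from c obtain K where K: "compact K" "K \<subseteq> \<Omega>" "\<And>x. x \<notin> K \<Longrightarrow> u x = 0"
    unfolding Cc_def by metis
  then have "\<And>x. x \<notin> K \<Longrightarrow> partial b u x = 0"
    using partial_zero_outside[of K u] compact_imp_closed by blast
  then show ?thesis
    using K C_1_continuous_partial[OF u b] unfolding Cc_def by blast
qed

lemma Cc_grad:
  assumes "C_k 1 u" "Cc \<Omega> u"
  shows "Cc \<Omega> (grad u)"
  unfolding grad_def[abs_def] using assms by (intro Cc_sum Cc_scaleR_left Cc_partial)

section \<open>Test functions as compactly supported functions\<close>

lemma test_function_C_1: "test_function \<Omega> \<phi> \<Longrightarrow> C_k 1 \<phi>"
  unfolding test_function_def by blast

lemma test_function_Cc: 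
  assumes "test_function \<Omega> \<phi>" 
  shows "Cc \<Omega> \<phi>"
proof -
  have "\<phi> x = 0" if "x \<notin> closure {x. \<phi> x \<noteq> 0}" for x
    using that closure_subset[of "{x. \<phi> x \<noteq> 0}"] by auto
  moreover have "compact (closure {x. \<phi> x \<noteq> 0})" "closure {x. \<phi> x \<noteq> 0} \<subseteq> \<Omega>"
    using assms unfolding test_function_def by fast+
  moreover note C_1_continuous[OF test_function_C_1[OF assms]]
  ultimately show ?thesis
    unfolding Cc_def by blast
qed

lemma test_functionI:
  assumes "\<And>k. C_k k \<phi>" "Cc \<Omega> \<phi>"
  shows "test_function \<Omega> \<phi>"
proof -
  from assms(2) obtain K where K: "compact K" "K \<subseteq> \<Omega>" "\<And>x. x \<notin> K \<Longrightarrow> \<phi> x = 0"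
    unfolding Cc_def by metis
  have sub: "closure {x. \<phi> x \<noteq> 0} \<subseteq> K"
    using K by (intro closure_minimal compact_imp_closed) auto
  have "compact (K \<inter> closure {x. \<phi> x \<noteq> 0})"
    using K(1) by (intro compact_Int_closed) auto
  then have "compact (closure {x. \<phi> x \<noteq> 0})" "closure {x. \<phi> x \<noteq> 0} \<subseteq> \<Omega>"
    using sub K(2) by (auto simp: Int_absorb1)
  then show ?thesis using assms(1) by (simp add: test_function_def)
qed

lemma test_function_add:
  "test_function \<Omega> \<phi> \<Longrightarrow> test_function \<Omega> \<psi> \<Longrightarrow> test_function \<Omega> (\<lambda>x. \<phi> x + \<psi> x)"
proof (rule test_functionI)
  assume a: "test_function \<Omega> \<phi>" "test_function \<Omega> \<psi>"
  show "C_k k (\<lambda>x. \<phi> x + \<psi> x)" for k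
    using a unfolding test_function_def by (intro C_k_add) blast+
  show "Cc \<Omega> (\<lambda>x. \<phi> x + \<psi> x)"
    using a[THEN test_function_Cc] by (rule Cc_add)
qed

lemma test_function_cmult:
  assumes "test_function \<Omega> \<phi>"
  shows "test_function \<Omega> (\<lambda>x. c * \<phi> x)"
proof (rule test_functionI)
  show "C_k k (\<lambda>x. c * \<phi> x)" for k
    using assms unfolding test_function_def by (intro C_k_mult C_k_const) blast
  show "Cc \<Omega> (\<lambda>x. c * \<phi> x)"
    using Cc_scaleR_right[OF test_function_Cc[OF assms], of c] by simp
qed

lemma test_function_partial:
  assumes "test_function \<Omega> \<phi>" "b \<in> Basis"
  shows "test_function \<Omega> (partial b \<phi>)"
proof (rule test_functionI)
  fix k
  have "C_k (Suc k) \<phi>" using assms(1) unfolding test_function_def by fast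
  then show "C_k k (partial b \<phi>)" using assms(2) by simp
next
  show "Cc \<Omega> (partial b \<phi>)"
    using assms by (intro Cc_partial test_function_C_1 test_function_Cc)
qed

lemma grad_add_cmult:
  assumes "f differentiable at x" "g differentiable at x"
  shows "grad (\<lambda>x. f x + c * g x) x = grad f x + c *\<^sub>R grad g x"
proof -
  have "(\<lambda>x. c * g x) differentiable at x" using assms(2) by (intro differentiable_mult) auto
  moreover have "partial b (\<lambda>x. c * g x) x = c * partial b g x" for b
    using partial_mult[of "\<lambda>x. c" x g b] assms(2) by (simp add: partial_const)
  ultimately show ?thesis
    using assms by (simp add: grad_def partial_add scaleR_add_left sum.distrib scaleR_sum_right)
qed

lemma partial_eq_grad: "b \<in> Basis \<Longrightarrow> partial b f x = grad f x \<bullet> b"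
  by (simp add: grad_def inner_sum_left inner_Basis if_distrib sum.delta cong: if_cong)

text \<open>The difference quotients in direction \<open>b\<close> have integral 0 by translation
  invariance, and they converge to the partial derivative under a common integrable bound. This
  works in any dimension without slicing the space into lines.\<close>

lemma integral_partial_eq_0:
  fixes u :: "'a::euclidean_space \<Rightarrow> real"
  assumes u: "C_k 1 u" and c: "Cc \<Omega> u" and b: "b \<in> Basis"
  shows "(LINT x|lborel. partial b u x) = 0"
proof -
  from c obtain K where K: "compact K" "\<And>x. x \<notin> K \<Longrightarrow> u x = 0"
    unfolding Cc_def by metis
  obtain R where R: "\<And>x. x \<in> K \<Longrightarrow> norm x \<le> R"
    using compact_imp_bounded[OF K(1)] unfolding bounded_iff by blast
  obtain B where B: "0 < B" "\<And>x. norm (partial b u x) \<le> B"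
    using Cc_bounded[OF Cc_partial[OF u c b]] by metis
  have um: "u \<in> borel_measurable borel" using c by (rule Cc_measurable)
  have ui: "integrable lborel u" using c by (rule Cc_integrable_lborel)
  define t where "t n = 1 / real (Suc n)" for n
  have t: "0 < t n" "t n \<le> 1" for n by (auto simp: t_def)
  have t0: "t \<longlonglongrightarrow> 0" unfolding t_def[abs_def] by (rule lim_1_over_n[THEN LIMSEQ_Suc])
  define q where "q n x = (u (x + t n *\<^sub>R b) - u x) / t n" for n x
  \<comment> \<open>The steps \<open>t n\<close> are at most 1 and \<open>b\<close> is a unit
    vector, so all quotients vanish outside the ball of radius \<open>R + 1\<close>; inside it the
    mean value theorem bounds them by the supremum \<open>B\<close> of the partial
    derivative.\<close>
  have "(\<lambda>n. LINT x|lborel. q n x) \<longlonglongrightarrow> (LINT x|lborel. partial b u x)"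
  proof (rule integral_dominated_convergence[where w = "\<lambda>x. B * indicator (cball 0 (R + 1)) x"])
    show "partial b u \<in> borel_measurable lborel"
      using C_1_continuous_partial[OF u b] by (simp add: borel_measurable_continuous_onI)
    show "q n \<in> borel_measurable lborel" for n
      unfolding q_def using um by measurable
    show "integrable lborel (\<lambda>x. B * indicator (cball (0::'a) (R + 1)) x)"
      by (intro integrable_mult_right integrable_real_indicator) (use emeasure_lborel_cball_finite in auto)
    have "(\<lambda>n. q n x) \<longlonglongrightarrow> partial b u x" for x
    proof -
      have "((\<lambda>r. u (x + r *\<^sub>R b)) has_real_derivative partial b u (x + 0 *\<^sub>R b)) (at 0)"
        by (rule has_real_derivative_along_line) (rule C_1_differentiable[OF u])
      then have "(\<lambda>h. (u (x + (0 + h) *\<^sub>R b) - u (x + 0 *\<^sub>R b)) / h) \<midarrow>0\<rightarrow> partial b u (x + 0 *\<^sub>R b)"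
        by (rule DERIV_D)
      then have l: "((\<lambda>h. (u (x + h *\<^sub>R b) - u x) / h) \<longlongrightarrow> partial b u x) (at 0)" by simp
      have "filterlim t (at 0) sequentially"
        using t0 t(1) by (auto simp: filterlim_at eventually_sequentially intro!: exI[of _ 0]) (metis less_irrefl)
      from filterlim_compose[OF l this] show ?thesis by (simp add: q_def)
    qed
    then show "AE x in lborel. (\<lambda>n. q n x) \<longlonglongrightarrow> partial b u x" by simp
    have "norm (q n x) \<le> B * indicator (cball 0 (R + 1)) x" for n x
    proof (cases "x \<in> cball 0 (R + 1)")
      case True
      have "\<exists>z. 0 < z \<and> z < t n \<and> u (x + t n *\<^sub>R b) - u (x + 0 *\<^sub>R b) = (t n - 0) * partial b u (x + z *\<^sub>R b)"
        using t(1) C_1_differentiable[OF u] by (intro MVT2 has_real_derivative_along_line)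
      then obtain z where "u (x + t n *\<^sub>R b) - u x = t n * partial b u (x + z *\<^sub>R b)" by auto
      then have "q n x = partial b u (x + z *\<^sub>R b)" using t(1)[of n] by (simp add: q_def)
      then show ?thesis using B(2) True by simp
    next
      case False
      then have "norm x > R + 1" by simp
      then have "x \<notin> K" using R by fastforce
      moreover have "norm (t n *\<^sub>R b) \<le> 1" using t[of n] b by simp
      then have "norm (x + t n *\<^sub>R b) > R"
        using \<open>norm x > R + 1\<close> norm_triangle_ineq4[of "x + t n *\<^sub>R b" "t n *\<^sub>R b"] by simp
      then have "x + t n *\<^sub>R b \<notin> K" using R by fastforce
      ultimately show ?thesis using K(2) False by (simp add: q_def)
    qed
    then show "AE x in lborel. norm (q n x) \<le> B * indicator (cball 0 (R + 1)) x" for n by simp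
  qed
  moreover have "(LINT x|lborel. q n x) = 0" for n
  proof -
    have "integrable (distr lborel borel ((+) (t n *\<^sub>R b))) u"
      using ui by (simp add: lborel_distr_plus)
    then have "integrable lborel (\<lambda>x. u (x + t n *\<^sub>R b))"
      using um by (subst (asm) integrable_distr_eq) (auto simp: add.commute)
    moreover have "integral\<^sup>L (distr lborel borel ((+) (t n *\<^sub>R b))) u = (LINT x|lborel. u (t n *\<^sub>R b + x))"
      using um by (intro integral_distr) auto
    then have "(LINT x|lborel. u (x + t n *\<^sub>R b)) = integral\<^sup>L lborel u"
      by (simp add: lborel_distr_plus add.commute)
    ultimately have s: "integrable lborel (\<lambda>x. u (x + t n *\<^sub>R b))"
      "(LINT x|lborel. u (x + t n *\<^sub>R b)) = integral\<^sup>L lborel u" by blast+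
    show ?thesis unfolding q_def using s ui by simp
  qed
  ultimately have "(\<lambda>n::nat. 0::real) \<longlonglongrightarrow> (LINT x|lborel. partial b u x)" by simp
  then show ?thesis by (simp add: LIMSEQ_const_iff)
qed

lemma integration_by_parts:
  fixes u v :: "'a::euclidean_space \<Rightarrow> real"
  assumes u: "C_k 1 u" "Cc \<Omega> u" and v: "C_k 1 v" "Cc \<Omega> v" and b: "b \<in> Basis"
  shows "(LINT x|lborel. u x * partial b v x) = - (LINT x|lborel. v x * partial b u x)"
proof -
  have prod: "Cc \<Omega> (\<lambda>x. f x * g x)" if "Cc \<Omega> f" "Cc \<Omega> g" for f g :: "'a \<Rightarrow> real"
    using that(1) by (rule Cc_comp[where H = "\<lambda>x y. y * g x"])
      (use Cc_continuous[OF that(2)] in \<open>auto intro!: continuous_intros\<close>)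
  have "0 = (LINT x|lborel. partial b (\<lambda>x. u x * v x) x)"
    using C_k_mult[OF u(1) v(1)] prod[OF u(2) v(2)] b by (rule integral_partial_eq_0[symmetric])
  also have "\<dots> = (LINT x|lborel. u x * partial b v x + v x * partial b u x)"
    using u v by (intro Bochner_Integration.integral_cong) (auto simp: partial_mult C_1_differentiable mult.commute)
  also have "\<dots> = (LINT x|lborel. u x * partial b v x) + (LINT x|lborel. v x * partial b u x)"
    using prod[OF u(2) Cc_partial[OF v b]] prod[OF v(2) Cc_partial[OF u b]]
    by (intro Bochner_Integration.integral_add Cc_integrable_lborel)
  finally show ?thesis by simp
qed

lemma test_function_weak_gradient:
  assumes "open \<Omega>" "test_function \<Omega> u"
  shows "has_weak_gradient \<Omega> u (grad u)"
  unfolding has_weak_gradient_def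
proof (intro allI impI)
  fix \<phi> assume \<phi>: "test_function \<Omega> \<phi>"
  note uC = test_function_C_1[OF assms(2)] test_function_Cc[OF assms(2)]
  note vC = test_function_C_1[OF \<phi>] test_function_Cc[OF \<phi>]
  have cc: "Cc \<Omega> (\<lambda>x. f x *\<^sub>R g x)" if "Cc \<Omega> f" "Cc \<Omega> g" for f :: "'a \<Rightarrow> real" and g :: "'a \<Rightarrow> 'a"
    using that(1) by (rule Cc_comp[where H = "\<lambda>x y. y *\<^sub>R g x"])
      (use Cc_continuous[OF that(2)] in \<open>auto intro!: continuous_intros\<close>)
  have I: "(LINT x|lebesgue_on \<Omega>. f x *\<^sub>R grad g x) \<bullet> b = (LINT x|lborel. f x * partial b g x)"
    if "C_k 1 f" "Cc \<Omega> f" "C_k 1 g" "Cc \<Omega> g" "b \<in> Basis" for f g b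
  proof -
    have "Cc \<Omega> (\<lambda>x. f x *\<^sub>R grad g x)" using that by (intro cc Cc_grad)
    then show ?thesis
      using that assms(1) by (simp add: Cc_integral Cc_integrable_lborel integral_inner_left[symmetric]
        inner_scaleR_left partial_eq_grad flip: integral_inner_left)
  qed
  show "(LINT x|lebesgue_on \<Omega>. u x *\<^sub>R grad \<phi> x) = - (LINT x|lebesgue_on \<Omega>. \<phi> x *\<^sub>R grad u x)"
    by (rule euclidean_eqI) (simp add: I[OF uC vC] I[OF vC uC] integration_by_parts[OF uC vC])
qed

lemma test_function_in_H10:
  assumes "open \<Omega>" "test_function \<Omega> u"
  shows "in_H10 \<Omega> u (grad u)"
  unfolding in_H10_def in_H1_def in_L2_iff
  using assms test_function_C_1[OF assms(2)] test_function_Cc[OF assms(2)]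
  by (auto simp: test_function_weak_gradient intro!: Cc_L2 Cc_grad exI[of _ "\<lambda>n. u"])

section \<open>Existence of the torsion function\<close>

lemma emeasure_lebesgue_on_space:
  "open \<Omega> \<Longrightarrow> emeasure (lebesgue_on \<Omega>) (space (lebesgue_on \<Omega>)) = emeasure lebesgue \<Omega>"
  by (simp add: emeasure_restrict_space)

lemma finite_measure_lebesgue_on:
  assumes "open \<Omega>" "emeasure lebesgue \<Omega> < \<infinity>"
  shows "finite_measure (lebesgue_on \<Omega>)"
  by (rule finite_measureI, subst emeasure_lebesgue_on_space) (use assms in auto)

text \<open>A square inside the domain has at most its area. This crude scale serves the existence
  proof, where no torsion function is available yet to provide the finer one.\<close>

lemma finite_measure_no_square:
  assumes "open \<Omega>" "emeasure lebesgue \<Omega> < \<infinity>"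
  obtains L where "0 < L" "no_square \<Omega> L"
proof -
  define L where "L = sqrt (measure lebesgue \<Omega>) + 1"
  have L: "0 < L" unfolding L_def by (simp add: add_nonneg_pos)
  have "measure lebesgue \<Omega> < L\<^sup>2"
    unfolding L_def by (simp add: power2_sum add_nonneg_pos add_pos_nonneg)
  have "\<not> cbox p (p + L *\<^sub>R 1) \<subseteq> \<Omega>" for p
  proof
    assume sub: "cbox p (p + L *\<^sub>R 1) \<subseteq> \<Omega>"
    have "measure lborel (cbox p (p + L *\<^sub>R 1)) = L\<^sup>2"
      using L by (subst content_cbox_cart) (auto simp: interval_eq_empty_cart UNIV_2 power2_eq_square)
    then have "L\<^sup>2 = measure lebesgue (cbox p (p + L *\<^sub>R 1))" by simp
    also have "\<dots> \<le> measure lebesgue \<Omega>"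
      using sub assms by (intro measure_mono_fmeasurable) (auto simp: fmeasurable_def)
    finally show False using \<open>measure lebesgue \<Omega> < L\<^sup>2\<close> by simp
  qed
  with L show ?thesis by (intro that[of L]) (auto simp: no_square_def)
qed

lemma poincare_L1_integral:
  fixes u :: "real^2 \<Rightarrow> real"
  assumes u: "C_k 1 u" "Cc \<Omega> u" and "open \<Omega>"
    and sc: "simply_connected \<Omega>" and ns: "no_square \<Omega> L" and L: "0 \<le> L"
  shows "(LINT x|lebesgue_on \<Omega>. \<bar>u x\<bar>) \<le> 2 * L *
    (LINT x|lebesgue_on \<Omega>. \<bar>partial (axis 1 1) u x\<bar> + \<bar>partial (axis 2 1) u x\<bar>)"
proof -
  have abs: "Cc \<Omega> (\<lambda>x. \<bar>f x\<bar>)" if "Cc \<Omega> f" for f :: "real^2 \<Rightarrow> real"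
    using that by (rule Cc_comp[where H = "\<lambda>x y. \<bar>y\<bar>"]) (auto intro!: continuous_intros)
  define D where "D x = \<bar>partial (axis 1 1) u x\<bar> + \<bar>partial (axis 2 1) u x\<bar>" for x
  have D: "Cc \<Omega> D"
    unfolding D_def[abs_def] by (intro Cc_add abs Cc_partial u) (auto simp: axis_in_Basis_iff)
  have D0: "D x \<ge> 0" for x by (simp add: D_def)
  have "ennreal (LINT x|lborel. \<bar>u x\<bar>) = (\<integral>\<^sup>+ x. ennreal \<bar>u x\<bar> \<partial>lborel)"
    by (intro nn_integral_eq_integral[symmetric] Cc_integrable_lborel[OF abs[OF u(2)]]) simp
  also have "\<dots> \<le> ennreal (2 * L) * (\<integral>\<^sup>+ x. ennreal (D x) \<partial>lborel)"
    using poincare_L1[OF u(1) Cc_zero[OF u(2)] sc ns L] by (simp add: D_def)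
  also have "\<dots> = ennreal (2 * L * (LINT x|lborel. D x))"
    using L D0 by (subst nn_integral_eq_integral[OF Cc_integrable_lborel[OF D]]) (auto simp: ennreal_mult)
  finally have "(LINT x|lborel. \<bar>u x\<bar>) \<le> 2 * L * (LINT x|lborel. D x)"
    using L D0 by (simp add: ennreal_le_iff)
  then show ?thesis
    using Cc_integral[OF assms(3) abs[OF u(2)]] Cc_integral[OF assms(3) D] unfolding D_def by simp
qed

lemma power2_norm_real_2: "(norm (v :: real^2))\<^sup>2 = (v \<bullet> axis 1 1)\<^sup>2 + (v \<bullet> axis 2 1)\<^sup>2"
  unfolding power2_norm_eq_inner by (simp add: inner_axis inner_vec_def[of v v] UNIV_2 power2_eq_square)

text \<open>Poincare for \<open>h (\<phi> x)\<close>, with the product of slope and gradient split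
  by Young's inequality. The weight \<open>\<kappa>\<close> is left free: the square as
  \<open>h\<close> gives the L^2 inequality, the squared sine gives the bound on the mean.\<close>

lemma poincare_truncated:
  fixes \<phi> :: "real^2 \<Rightarrow> real"
  assumes \<Omega>: "open \<Omega>" "emeasure lebesgue \<Omega> < \<infinity>" "simply_connected \<Omega>" "no_square \<Omega> L" and L: "0 \<le> L"
    and \<phi>: "test_function \<Omega> \<phi>"
    and h: "h 0 = 0" "\<And>t. (h has_real_derivative h' t) (at t)" "continuous_on UNIV h'" and "0 < \<kappa>"
  shows "(LINT x|lebesgue_on \<Omega>. \<bar>h (\<phi> x)\<bar>) \<le> L * (\<kappa> * (LINT x|lebesgue_on \<Omega>. (h' (\<phi> x))\<^sup>2)
    + 2 / \<kappa> * (LINT x|lebesgue_on \<Omega>. (norm (grad \<phi> x))\<^sup>2))"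
proof -
  let ?M = "lebesgue_on \<Omega>"
  note C1 = test_function_C_1[OF \<phi>] and Cc = test_function_Cc[OF \<phi>]
  have b: "axis 1 1 \<in> (Basis :: (real^2) set)" "axis 2 1 \<in> (Basis :: (real^2) set)"
    by (simp_all add: axis_in_Basis_iff)
  have hc: "continuous_on UNIV h"
    using h(2) by (meson DERIV_isCont continuous_at_imp_continuous_on)
  have u: "C_k 1 (\<lambda>x. h (\<phi> x))" by (rule C_1_chain[OF C1 h(2,3)])
  have uc: "Cc \<Omega> (\<lambda>x. h (\<phi> x))"
    using Cc by (rule Cc_comp[where H = "\<lambda>x. h"]) (use h(1) continuous_on_compose2[OF hc] in auto)
  \<comment> \<open>\<open>h' 0\<close> may be nonzero, so this function need not have compact
    support; it is bounded, however, and the measure is finite.\<close>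
  have L2h: "L2 ?M (\<lambda>x. h' (\<phi> x))"
  proof -
    interpret finite_measure ?M
      using \<Omega>(1,2) by (rule finite_measure_lebesgue_on)
    obtain B where B: "\<And>x. norm (\<phi> x) \<le> B" using Cc_bounded[OF Cc] by blast
    have "compact (h' ` {-B..B})"
      using h(3) by (intro compact_continuous_image) (auto intro: continuous_on_subset)
    then obtain K where K: "\<And>t. t \<in> {-B..B} \<Longrightarrow> \<bar>h' t\<bar> \<le> K"
      by (metis bounded_iff compact_imp_bounded imageI real_norm_def)
    have m: "(\<lambda>x. h' (\<phi> x)) \<in> borel_measurable ?M"
      using Cc_integrable[OF \<Omega>(1) Cc] borel_measurable_continuous_onI[OF h(3)] by simp
    have "(h' (\<phi> x))\<^sup>2 \<le> K\<^sup>2" for x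
      using K[of "\<phi> x"] B[of x] by (intro abs_le_square_iff[THEN iffD1]) (auto simp: abs_le_iff)
    then have "integrable ?M (\<lambda>x. (h' (\<phi> x))\<^sup>2)"
      using m by (intro integrable_const_bound[of _ "K\<^sup>2"]) auto
    with m show ?thesis by (simp add: L2_def)
  qed
  have L2g: "L2 ?M (grad \<phi>)" by (intro Cc_L2 \<Omega>(1) Cc_grad C1 Cc)
  let ?D = "\<lambda>x. \<bar>partial (axis 1 1) (\<lambda>x. h (\<phi> x)) x\<bar> + \<bar>partial (axis 2 1) (\<lambda>x. h (\<phi> x)) x\<bar>"
  let ?R = "\<lambda>x. \<kappa> / 2 * (h' (\<phi> x))\<^sup>2 + 1 / \<kappa> * (norm (grad \<phi> x))\<^sup>2"
  have Dle: "?D x \<le> ?R x" for x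
  proof -
    define p q a where "p = \<bar>partial (axis 1 1) \<phi> x\<bar>" and "q = \<bar>partial (axis 2 1) \<phi> x\<bar>" and "a = \<bar>h' (\<phi> x)\<bar>"
    have "?D x = a * (p + q)"
      using partial_chain(1)[OF C_1_differentiable[OF C1] h(2)]
      by (simp add: p_def q_def a_def abs_mult distrib_left)
    also have "\<dots> \<le> \<kappa> / 2 * a\<^sup>2 + 1 / \<kappa> * (p\<^sup>2 + q\<^sup>2)"
    proof -
      \<comment> \<open>The first square is Young's inequality, the second replaces (p + q)^2 by 2
        (p^2 + q^2), the squared norm of the gradient.\<close>
      have "0 \<le> (\<kappa> * a - (p + q))\<^sup>2 + (p - q)\<^sup>2" by simp
      also have "\<dots> = 2 * \<kappa> * (\<kappa> / 2 * a\<^sup>2 + 1 / \<kappa> * (p\<^sup>2 + q\<^sup>2) - a * (p + q))"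
        using \<open>0 < \<kappa>\<close> by (simp add: field_simps power2_eq_square)
      finally show ?thesis using \<open>0 < \<kappa>\<close> by (simp add: zero_le_mult_iff)
    qed
    also have "\<dots> = ?R x"
      using b by (simp add: power2_norm_real_2 p_def q_def a_def flip: partial_eq_grad)
    finally show ?thesis .
  qed
  have iR: "integrable ?M ?R" using L2h L2g by (auto simp: L2_def)
  have iD: "integrable ?M ?D"
  proof -
    have "Cc \<Omega> (partial b (\<lambda>x. h (\<phi> x)))" if "b \<in> Basis" for b by (rule Cc_partial[OF u uc that])
    then show ?thesis using b \<Omega>(1) by (intro Bochner_Integration.integrable_add integrable_abs Cc_integrable)
  qed
  have "(LINT x|?M. \<bar>h (\<phi> x)\<bar>) \<le> 2 * L * (LINT x|?M. ?D x)"
    by (rule poincare_L1_integral[OF u uc \<Omega>(1,3,4) L])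
  also have "\<dots> \<le> 2 * L * (LINT x|?M. ?R x)"
    using L by (intro mult_left_mono integral_mono iD iR Dle) auto
  also have "(LINT x|?M. ?R x) = \<kappa> / 2 * (LINT x|?M. (h' (\<phi> x))\<^sup>2) + 1 / \<kappa> * (LINT x|?M. (norm (grad \<phi> x))\<^sup>2)"
    using L2h L2g by (simp add: L2_def)
  finally show ?thesis by (simp add: algebra_simps)
qed

text \<open>For \<open>h\<close> the square, the slope term is \<open>4 * L * \<kappa>\<close> times
  the left side. The weight \<open>1 / (8 * L)\<close> makes this one half, which is absorbed, and
  leaves 16 L^2 in front of the energy before doubling.\<close>

lemma poincare_L2:
  fixes \<phi> :: "real^2 \<Rightarrow> real"
  assumes "open \<Omega>" "emeasure lebesgue \<Omega> < \<infinity>" "simply_connected \<Omega>" "no_square \<Omega> L" "0 < L"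
    and "test_function \<Omega> \<phi>"
  shows "(LINT x|lebesgue_on \<Omega>. (\<phi> x)\<^sup>2) \<le> 32 * L\<^sup>2 * (LINT x|lebesgue_on \<Omega>. (norm (grad \<phi> x))\<^sup>2)"
proof -
  define G where "G = (LINT x|lebesgue_on \<Omega>. (norm (grad \<phi> x))\<^sup>2)"
  have "(LINT x|lebesgue_on \<Omega>. \<bar>(\<phi> x)\<^sup>2\<bar>) \<le> L * (1 / (8 * L) * (LINT x|lebesgue_on \<Omega>. (2 * \<phi> x)\<^sup>2)
    + 2 / (1 / (8 * L)) * G)"
    unfolding G_def
    by (rule poincare_truncated[where h = "\<lambda>t. t\<^sup>2" and h' = "\<lambda>t. 2 * t"])
      (use assms in \<open>auto intro!: derivative_eq_intros continuous_intros\<close>)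
  then have "(LINT x|lebesgue_on \<Omega>. (\<phi> x)\<^sup>2) \<le> 1 / 2 * (LINT x|lebesgue_on \<Omega>. (\<phi> x)\<^sup>2) + 16 * L\<^sup>2 * G"
    using \<open>0 < L\<close> by (simp add: power_mult_distrib power2_eq_square distrib_left)
  then show ?thesis by (simp add: G_def)
qed

section \<open>Weak gradients and approximation in H^1_0\<close>

lemma L2_integrable_scaleR:
  fixes f :: "'a \<Rightarrow> real" and g :: "'a \<Rightarrow> 'b::euclidean_space"
  assumes f: "L2 M f" and g: "L2 M g"
  shows "integrable M (\<lambda>x. f x *\<^sub>R g x)"
proof (rule Bochner_Integration.integrable_bound)
  have "L2 M (\<lambda>x. norm (g x))" "L2 M (\<lambda>x. norm (f x))"
    using f g by (auto simp: L2_def)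
  then show "integrable M (\<lambda>x. norm (f x) \<bullet> norm (g x))" by (rule L2_integrable_inner[rotated])
  show "(\<lambda>x. f x *\<^sub>R g x) \<in> borel_measurable M"
    using f[THEN L2_measurable] g[THEN L2_measurable] by measurable
qed (auto simp: abs_mult)

text \<open>Reduces the vector identity to scalar ones, to which the convergence of inner products
  applies.\<close>

lemma weak_gradient_componentwise:
  fixes u :: "'a::euclidean_space \<Rightarrow> real"
  assumes \<Omega>: "open \<Omega>" and u: "L2 (lebesgue_on \<Omega>) u" and g: "L2 (lebesgue_on \<Omega>) g" and \<phi>: "test_function \<Omega> \<phi>"
  shows "(LINT x|lebesgue_on \<Omega>. u x *\<^sub>R grad \<phi> x) = - (LINT x|lebesgue_on \<Omega>. \<phi> x *\<^sub>R g x) \<longleftrightarrow>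
    (\<forall>b\<in>Basis. (LINT x|lebesgue_on \<Omega>. u x * partial b \<phi> x) = - (LINT x|lebesgue_on \<Omega>. \<phi> x * (g x \<bullet> b)))"
proof -
  let ?M = "lebesgue_on \<Omega>"
  have L2\<phi>: "L2 ?M \<phi>" "L2 ?M (grad \<phi>)"
    using \<Omega> test_function_C_1[OF \<phi>] test_function_Cc[OF \<phi>] by (auto intro!: Cc_L2 Cc_grad)
  have "(LINT x|?M. u x *\<^sub>R grad \<phi> x) \<bullet> b = (LINT x|?M. u x * partial b \<phi> x)" if "b \<in> Basis" for b
    using that L2_integrable_scaleR[OF u L2\<phi>(2)]
    by (subst integral_inner_left[symmetric]) (auto simp: partial_eq_grad)
  moreover have "(LINT x|?M. \<phi> x *\<^sub>R g x) \<bullet> b = (LINT x|?M. \<phi> x * (g x \<bullet> b))" for b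
    using L2_integrable_scaleR[OF L2\<phi>(1) g] by (subst integral_inner_left[symmetric]) auto
  ultimately show ?thesis
    by (auto simp: euclidean_eq_iff[where 'a = 'a])
qed

lemma in_H10_approx:
  assumes "in_H10 \<Omega> u g"
  obtains \<phi> where "\<And>n::nat. test_function \<Omega> (\<phi> n)"
    "(\<lambda>n. LINT x|lebesgue_on \<Omega>. (norm (\<phi> n x - u x))\<^sup>2) \<longlonglongrightarrow> 0"
    "(\<lambda>n. LINT x|lebesgue_on \<Omega>. (norm (grad (\<phi> n) x - g x))\<^sup>2) \<longlonglongrightarrow> 0"
proof -
  from assms obtain \<phi> where t: "\<And>n::nat. test_function \<Omega> (\<phi> n)" and l: "(\<lambda>n. (LINT x|lebesgue_on \<Omega>. (\<phi> n x - u x)\<^sup>2) +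
             (LINT x|lebesgue_on \<Omega>. (norm (grad (\<phi> n) x - g x))\<^sup>2)) \<longlonglongrightarrow> 0"
    unfolding in_H10_def by blast
  have "(\<lambda>n. LINT x|lebesgue_on \<Omega>. (norm (\<phi> n x - u x))\<^sup>2) \<longlonglongrightarrow> 0"
    by (rule tendsto_sandwich[OF always_eventually always_eventually tendsto_const l]) auto
  moreover have "(\<lambda>n. LINT x|lebesgue_on \<Omega>. (norm (grad (\<phi> n) x - g x))\<^sup>2) \<longlonglongrightarrow> 0"
    by (rule tendsto_sandwich[OF always_eventually always_eventually tendsto_const l]) auto
  ultimately show ?thesis using t that by blast
qed

lemma L2_test_function:
  assumes "open \<Omega>" "test_function \<Omega> \<phi>"
  shows "L2 (lebesgue_on \<Omega>) \<phi>" "L2 (lebesgue_on \<Omega>) (grad \<phi>)"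
  by (intro Cc_L2 Cc_grad assms(1) test_function_C_1[OF assms(2)] test_function_Cc[OF assms(2)])+

text \<open>Test functions satisfy the weak gradient identity by integration by parts, and each
  component of it survives L^2 limits; approximability therefore already entails membership in
  H^1.\<close>

lemma in_H10I:
  fixes \<phi> :: "nat \<Rightarrow> 'a::euclidean_space \<Rightarrow> real"
  assumes \<Omega>: "open \<Omega>" and t: "\<And>n. test_function \<Omega> (\<phi> n)"
    and u: "L2 (lebesgue_on \<Omega>) u" and g: "L2 (lebesgue_on \<Omega>) g"
    and lu: "(\<lambda>n. LINT x|lebesgue_on \<Omega>. (norm (\<phi> n x - u x))\<^sup>2) \<longlonglongrightarrow> 0"
    and lg: "(\<lambda>n. LINT x|lebesgue_on \<Omega>. (norm (grad (\<phi> n) x - g x))\<^sup>2) \<longlonglongrightarrow> 0"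
  shows "in_H10 \<Omega> u g"
proof -
  let ?M = "lebesgue_on \<Omega>"
  have "has_weak_gradient \<Omega> u g"
    unfolding has_weak_gradient_def
  proof (intro allI impI)
    fix \<psi> assume \<psi>: "test_function \<Omega> \<psi>"
    note L2\<psi> = L2_test_function[OF \<Omega> \<psi>]
    have "(LINT x|?M. u x * partial b \<psi> x) = - (LINT x|?M. \<psi> x * (g x \<bullet> b))" if b: "b \<in> Basis" for b
    proof (rule LIMSEQ_unique)
      have "L2 ?M (partial b \<psi>)"
        using \<Omega> test_function_Cc[OF test_function_partial[OF \<psi> b]] by (rule Cc_L2)
      from L2_tendsto_inner[OF L2_test_function(1)[OF \<Omega> t] u this lu]
      show "(\<lambda>n. LINT x|?M. \<phi> n x * partial b \<psi> x) \<longlonglongrightarrow> (LINT x|?M. u x * partial b \<psi> x)"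
        by simp
      have "L2 ?M (\<lambda>x. \<psi> x *\<^sub>R b)" using L2\<psi>(1) by (auto simp: L2_def power_mult_distrib)
      from L2_tendsto_inner[OF L2_test_function(2)[OF \<Omega> t] g this lg]
      have "(\<lambda>n. LINT x|?M. \<psi> x * (grad (\<phi> n) x \<bullet> b)) \<longlonglongrightarrow> (LINT x|?M. \<psi> x * (g x \<bullet> b))" by simp
      then have "(\<lambda>n. - (LINT x|?M. \<psi> x * (grad (\<phi> n) x \<bullet> b))) \<longlonglongrightarrow> - (LINT x|?M. \<psi> x * (g x \<bullet> b))"
        by (rule tendsto_minus)
      moreover have "- (LINT x|?M. \<psi> x * (grad (\<phi> n) x \<bullet> b)) = (LINT x|?M. \<phi> n x * partial b \<psi> x)" for n
        using weak_gradient_componentwise[OF \<Omega> L2_test_function[OF \<Omega> t] \<psi>, of n n]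
          test_function_weak_gradient[OF \<Omega> t, of n] \<psi> b by (simp add: has_weak_gradient_def)
      ultimately show "(\<lambda>n. LINT x|?M. \<phi> n x * partial b \<psi> x) \<longlonglongrightarrow> - (LINT x|?M. \<psi> x * (g x \<bullet> b))"
        by simp
    qed
    then show "(LINT x|?M. u x *\<^sub>R grad \<psi> x) = - (LINT x|?M. \<psi> x *\<^sub>R g x)"
      using weak_gradient_componentwise[OF \<Omega> u g \<psi>] by blast
  qed
  then show ?thesis
    unfolding in_H10_def in_H1_def in_L2_iff
    using t u g tendsto_add[OF lu lg] by (intro conjI exI[of _ \<phi>]) auto
qed

text \<open>The energy \<open>J\<close> is minimised over test functions. Strong convexity makes a
  minimising sequence of gradients Cauchy, and Poincare transfers this to the functions. The weak
  equation is derived along the sequence and passes to the limit, so \<open>J\<close> is never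
  evaluated at the limit.\<close>

lemma torsion_function_exists:
  fixes \<Omega> :: "(real^2) set"
  assumes \<Omega>: "open \<Omega>" "emeasure lebesgue \<Omega> < \<infinity>" "simply_connected \<Omega>"
  shows "\<exists>w. is_torsion_function \<Omega> w"
proof -
  let ?M = "lebesgue_on \<Omega>"
  have fin: "emeasure ?M (space ?M) < \<infinity>" using \<Omega> by (simp only: emeasure_lebesgue_on_space)
  define T where "T = {\<phi>. test_function \<Omega> \<phi>}"
  define G where "G \<phi> = (LINT x|?M. (norm (grad \<phi> x))\<^sup>2)" for \<phi> :: "real^2 \<Rightarrow> real"
  define I where "I \<phi> = (LINT x|?M. \<phi> x)" for \<phi> :: "real^2 \<Rightarrow> real"
  define B where "B \<phi> \<psi> = (LINT x|?M. grad \<phi> x \<bullet> grad \<psi> x)" for \<phi> \<psi> :: "real^2 \<Rightarrow> real"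
  define J where "J \<phi> = G \<phi> / 2 - I \<phi>" for \<phi>
  obtain L where L: "0 < L" "no_square \<Omega> L"
    using finite_measure_no_square[OF \<Omega>(1,2)] .
  have T_line: "(\<lambda>x. \<phi> x + t * \<psi> x) \<in> T" if "\<phi> \<in> T" "\<psi> \<in> T" for \<phi> \<psi> t
    using that unfolding T_def by (auto intro!: test_function_add test_function_cmult)
  have L2T: "L2 ?M \<phi>" "L2 ?M (grad \<phi>)" if "\<phi> \<in> T" for \<phi>
    using that L2_test_function[OF \<Omega>(1)] by (auto simp: T_def)
  have diffT: "\<phi> differentiable at x" if "\<phi> \<in> T" for \<phi> x
    using that C_1_differentiable[OF test_function_C_1] by (auto simp: T_def)
  have grad_line: "grad (\<lambda>x. \<phi> x + t * \<psi> x) = (\<lambda>x. grad \<phi> x + t *\<^sub>R grad \<psi> x)" if "\<phi> \<in> T" "\<psi> \<in> T" for \<phi> \<psi> t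
    using that by (intro ext grad_add_cmult diffT)
  have int1: "integrable ?M \<phi>" if "L2 ?M \<phi>" for \<phi> :: "real^2 \<Rightarrow> real"
    using L2_integrable_inner[OF that L2_const[OF fin, of 1]] by simp
  have G_line: "G (\<lambda>x. \<phi> x + t * \<psi> x) = G \<phi> + 2 * t * B \<phi> \<psi> + t\<^sup>2 * G \<psi>" if "\<phi> \<in> T" "\<psi> \<in> T" for \<phi> \<psi> t
    unfolding G_def B_def grad_line[OF that] using that by (intro L2_integral_square_add L2T)
  have I_line: "I (\<lambda>x. \<phi> x + t * \<psi> x) = I \<phi> + t * I \<psi>" if "\<phi> \<in> T" "\<psi> \<in> T" for \<phi> \<psi> t
    unfolding I_def using that by (simp add: int1 L2T)
  have J_line: "J (\<lambda>x. \<phi> x + t * \<psi> x) = J \<phi> + t * (B \<phi> \<psi> - I \<psi>) + t\<^sup>2 / 2 * G \<psi>" if "\<phi> \<in> T" "\<psi> \<in> T" for \<phi> \<psi> t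
    unfolding J_def G_line[OF that] I_line[OF that] by (simp add: field_simps)
  have poinc: "(LINT x|?M. (\<phi> x)\<^sup>2) \<le> 32 * L\<^sup>2 * G \<phi>" if "\<phi> \<in> T" for \<phi>
    unfolding G_def using that by (intro poincare_L2 \<Omega> L) (simp add: T_def)
  \<comment> \<open>Young's inequality weighted by the Poincare constant \<open>K\<close>: the
    square term costs at most \<open>G \<phi> / 2\<close>, exactly what \<open>J\<close> contains,
    and a multiple of the area remains.\<close>
  have J_low: "- (16 * L\<^sup>2 * measure ?M (space ?M)) \<le> J \<phi>" if "\<phi> \<in> T" for \<phi>
  proof -
    define K where "K = 32 * L\<^sup>2"
    have K: "0 < K" using L by (simp add: K_def)
    have "I \<phi> \<le> (LINT x|?M. 1 / (2 * K) * (\<phi> x)\<^sup>2 + K / 2 * 1\<^sup>2)"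
      unfolding I_def
    proof (rule integral_mono)
      show "integrable ?M (\<lambda>x. 1 / (2 * K) * (\<phi> x)\<^sup>2 + K / 2 * 1\<^sup>2)"
        using L2_integrable_square[OF L2T(1)[OF that]] L2_integrable_square[OF L2_const[OF fin, of "1::real"]]
        by (intro Bochner_Integration.integrable_add integrable_mult_right) simp_all
      show "\<phi> x \<le> 1 / (2 * K) * (\<phi> x)\<^sup>2 + K / 2 * 1\<^sup>2" for x
      proof -
        have "0 \<le> (\<phi> x - K)\<^sup>2 / (2 * K)" using K by simp
        also have "\<dots> = 1 / (2 * K) * (\<phi> x)\<^sup>2 + K / 2 * 1\<^sup>2 - \<phi> x"
          using K by (simp add: power2_eq_square field_simps)
        finally show ?thesis by simp
      qed
    qed (use that in \<open>auto intro: int1 L2T\<close>)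
    also have "\<dots> = (LINT x|?M. 1 / (2 * K) * (\<phi> x)\<^sup>2) + (LINT x|?M. K / 2 * 1\<^sup>2)"
      using L2_integrable_square[OF L2T(1)[OF that]] L2_integrable_square[OF L2_const[OF fin, of "1::real"]]
      by (intro Bochner_Integration.integral_add integrable_mult_right) simp_all
    also have "\<dots> = 1 / (2 * K) * (LINT x|?M. (\<phi> x)\<^sup>2) + K / 2 * measure ?M (space ?M)"
      by simp
    also have "1 / (2 * K) * (LINT x|?M. (\<phi> x)\<^sup>2) \<le> 1 / (2 * K) * (K * G \<phi>)"
      using poinc[OF that] K by (intro mult_left_mono) (auto simp: K_def)
    also have "\<dots> = G \<phi> / 2" using K by simp
    finally show ?thesis by (simp add: J_def K_def)
  qed
  define m where "m = (INF \<phi>\<in>T. J \<phi>)"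
  have zeroT: "(\<lambda>x. 0) \<in> T"
    unfolding T_def by (auto intro!: test_functionI C_k_const exI[of _ "{}"] simp: Cc_def)
  have bdd: "bdd_below (J ` T)" using J_low by (intro bdd_belowI2)
  have m_le: "m \<le> J \<phi>" if "\<phi> \<in> T" for \<phi> unfolding m_def using bdd that by (rule cINF_lower)
  have "\<exists>\<phi>\<in>T. J \<phi> < m + 1 / real (Suc n)" for n
    using cINF_less_iff[of T J "m + 1 / real (Suc n)"] zeroT bdd by (auto simp: m_def)
  then obtain \<phi> where \<phi>: "\<And>n. \<phi> n \<in> T" "\<And>n. J (\<phi> n) < m + 1 / real (Suc n)" by metis
  have D: "(\<lambda>x. \<phi> i x + (- 1) * \<phi> j x) \<in> T" for i j by (intro T_line \<phi>)
  \<comment> \<open>The parallelogram argument: \<open>J\<close> is quadratic on the line from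
    \<open>\<phi> j\<close> to \<open>\<phi> i\<close>, and its midpoint value, at least
    \<open>m\<close>, lies below the mean of the end values by \<open>G\<close> of the difference
    over 8.\<close>
  have G_diff: "G (\<lambda>x. \<phi> i x + (- 1) * \<phi> j x) \<le> 4 * (1 / real (Suc i) + 1 / real (Suc j))" for i j
  proof -
    let ?\<psi> = "\<lambda>x. \<phi> i x + (- 1) * \<phi> j x"
    have "J (\<phi> i) = J (\<lambda>x. \<phi> j x + 1 * ?\<psi> x)" by simp
    also have "\<dots> = J (\<phi> j) + (B (\<phi> j) ?\<psi> - I ?\<psi>) + G ?\<psi> / 2"
      using J_line[OF \<phi>(1) D, of j 1 i j] by simp
    finally have "J (\<phi> i) = J (\<phi> j) + (B (\<phi> j) ?\<psi> - I ?\<psi>) + G ?\<psi> / 2" .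
    moreover have "m \<le> J (\<phi> j) + (B (\<phi> j) ?\<psi> - I ?\<psi>) / 2 + G ?\<psi> / 8"
      using m_le[OF T_line[OF \<phi>(1) D, of j "1/2" i j]] J_line[OF \<phi>(1) D, of j "1/2" i j]
      by (simp add: power2_eq_square)
    moreover have "G' \<le> 4 * (p + q)"
      if "Ji = Jj + X + G' / 2" "m \<le> Jj + X / 2 + G' / 8" "Ji < m + p" "Jj < m + q" for Ji Jj X G' p q
    proof -
      have X: "X = Ji - Jj - G' / 2" using that(1) by simp
      have "8 * m \<le> 4 * (Ji + Jj) - G'" using that(2) unfolding X by (simp add: field_simps)
      then show ?thesis using that(3,4) by simp
    qed
    ultimately show ?thesis using \<phi>(2)[of i] \<phi>(2)[of j] by blast
  qed
  have small: "\<exists>N. \<forall>i\<ge>N. \<forall>j\<ge>N. c * G (\<lambda>x. \<phi> i x + (- 1) * \<phi> j x) < e" if "0 < e" "0 < c" for e c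
  proof -
    have "0 < e / (8 * c)" using that by simp
    from reals_Archimedean[OF this] obtain N where N: "1 / real (Suc N) < e / (8 * c)"
      by (auto simp: inverse_eq_divide)
    have "c * G (\<lambda>x. \<phi> i x + (- 1) * \<phi> j x) < e" if "i \<ge> N" "j \<ge> N" for i j
    proof -
      have "1 / real (Suc i) \<le> 1 / real (Suc N)" "1 / real (Suc j) \<le> 1 / real (Suc N)"
        using that by (auto intro!: divide_left_mono)
      then have "G (\<lambda>x. \<phi> i x + (- 1) * \<phi> j x) < e / c"
      proof -
        have "e / (8 * c) = e / c / 8" by simp
        then have "1 / real (Suc N) < e / c / 8" using N by (simp only:)
        then show ?thesis
          using G_diff[of i j] \<open>1 / real (Suc i) \<le> 1 / real (Suc N)\<close> \<open>1 / real (Suc j) \<le> 1 / real (Suc N)\<close>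
          by argo
      qed
      then show ?thesis using \<open>0 < c\<close> by (simp add: field_simps)
    qed
    then show ?thesis by blast
  qed
  have "\<exists>N. \<forall>i\<ge>N. \<forall>j\<ge>N. (LINT x|?M. (norm (\<phi> i x - \<phi> j x))\<^sup>2) < e" if "0 < e" for e
  proof -
    have "(LINT x|?M. (norm (\<phi> i x - \<phi> j x))\<^sup>2) \<le> 32 * L\<^sup>2 * G (\<lambda>x. \<phi> i x + (- 1) * \<phi> j x)" for i j
      using poinc[OF D, of i j] by simp
    then show ?thesis using small[OF that, of "32 * L\<^sup>2"] L by (meson le_less_trans zero_less_mult_iff zero_less_numeral zero_less_power)
  qed
  from L2_complete[OF fin L2T(1)[OF \<phi>(1)] this]
  obtain w where w: "L2 ?M w" "(\<lambda>n. LINT x|?M. (norm (\<phi> n x - w x))\<^sup>2) \<longlonglongrightarrow> 0" by blast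
  have "\<exists>N. \<forall>i\<ge>N. \<forall>j\<ge>N. (LINT x|?M. (norm (grad (\<phi> i) x - grad (\<phi> j) x))\<^sup>2) < e" if "0 < e" for e
    using small[OF that, of 1] unfolding G_def grad_line[OF \<phi>(1) \<phi>(1)] by simp
  from L2_complete[OF fin L2T(2)[OF \<phi>(1)] this]
  obtain g where g: "L2 ?M g" "(\<lambda>n. LINT x|?M. (norm (grad (\<phi> n) x - g x))\<^sup>2) \<longlonglongrightarrow> 0" by blast
  have H10: "in_H10 \<Omega> w g"
    using \<phi>(1) w g by (intro in_H10I[OF \<Omega>(1)]) (auto simp: T_def)
  have weak: "(LINT x|?M. g x \<bullet> grad \<psi> x) = I \<psi>" if \<psi>: "\<psi> \<in> T" for \<psi>
  proof (rule LIMSEQ_unique)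
    show "(\<lambda>n. B (\<phi> n) \<psi>) \<longlonglongrightarrow> (LINT x|?M. g x \<bullet> grad \<psi> x)"
      unfolding B_def by (rule L2_tendsto_inner[OF L2T(2)[OF \<phi>(1)] g(1) L2T(2)[OF \<psi>] g(2)])
    \<comment> \<open>The quadratic in \<open>t\<close> is the excess of \<open>J\<close> over its
      infimum along direction \<open>\<psi>\<close>, hence nonnegative; its linear coefficient, half
      the first variation, is controlled by the excess at \<open>\<phi> n\<close>, which tends to
      0.\<close>
    have "((B (\<phi> n) \<psi> - I \<psi>) / 2)\<^sup>2 \<le> (J (\<phi> n) - m) * (G \<psi> / 2)" for n
    proof (rule quadratic_nonneg_discriminant)
      show "0 \<le> J (\<phi> n) - m + 2 * t * ((B (\<phi> n) \<psi> - I \<psi>) / 2) + t\<^sup>2 * (G \<psi> / 2)" for t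
        using m_le[OF T_line[OF \<phi>(1) \<psi>, of n t]] J_line[OF \<phi>(1) \<psi>, of n t] by simp
    qed (simp add: G_def)
    also have "(J (\<phi> n) - m) * (G \<psi> / 2) \<le> 1 / real (Suc n) * (G \<psi> / 2)" for n
      using \<phi>(2)[of n] by (intro mult_right_mono) (auto simp: G_def)
    finally have "((B (\<phi> n) \<psi> - I \<psi>) / 2)\<^sup>2 \<le> 1 / real (Suc n) * (G \<psi> / 2)" for n .
    then have "4 * ((B (\<phi> n) \<psi> - I \<psi>) / 2)\<^sup>2 \<le> 4 * (1 / real (Suc n) * (G \<psi> / 2))" for n
      by (intro mult_left_mono) auto
    then have "(B (\<phi> n) \<psi> - I \<psi>)\<^sup>2 \<le> 2 * G \<psi> * (1 / real (Suc n))" for n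
      by (simp add: power_divide mult.commute del: of_nat_Suc)
    moreover have "(\<lambda>n. 2 * G \<psi> * (1 / real (Suc n))) \<longlonglongrightarrow> 0"
    proof (rule tendsto_mult_right_zero)
      show "(\<lambda>n. 1 / real (Suc n)) \<longlonglongrightarrow> 0" by (rule lim_1_over_n[THEN LIMSEQ_Suc])
    qed
    ultimately have "(\<lambda>n. B (\<phi> n) \<psi> - I \<psi>) \<longlonglongrightarrow> 0"
      by (rule tendsto_zero_if_square_le)
    then show "(\<lambda>n. B (\<phi> n) \<psi>) \<longlonglongrightarrow> I \<psi>"
      by (simp add: LIM_zero_iff)
  qed
  \<comment> \<open>Both sides are continuous in H^1, so the equation extends from test functions to
    their closure.\<close>
  have "(LINT x|?M. g x \<bullet> h x) = (LINT x|?M. v x)" if vh: "in_H10 \<Omega> v h" for v h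
  proof -
    from vh have L2v: "L2 ?M v" "L2 ?M h" by (auto simp: in_H10_def in_H1_def in_L2_iff)
    obtain \<psi> where \<psi>: "\<And>n::nat. test_function \<Omega> (\<psi> n)"
      "(\<lambda>n. LINT x|?M. (norm (\<psi> n x - v x))\<^sup>2) \<longlonglongrightarrow> 0"
      "(\<lambda>n. LINT x|?M. (norm (grad (\<psi> n) x - h x))\<^sup>2) \<longlonglongrightarrow> 0"
      using in_H10_approx[OF vh] by blast
    note L2\<psi> = L2_test_function[OF \<Omega>(1) \<psi>(1)]
    have "(\<lambda>n. LINT x|?M. grad (\<psi> n) x \<bullet> g x) \<longlonglongrightarrow> (LINT x|?M. h x \<bullet> g x)"
      by (rule L2_tendsto_inner[OF L2\<psi>(2) L2v(2) g(1) \<psi>(3)])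
    moreover have "(LINT x|?M. grad (\<psi> n) x \<bullet> g x) = (LINT x|?M. \<psi> n x)" for n
      using weak[of "\<psi> n"] \<psi>(1) by (simp add: T_def I_def inner_commute)
    ultimately have "(\<lambda>n. LINT x|?M. \<psi> n x) \<longlonglongrightarrow> (LINT x|?M. g x \<bullet> h x)"
      by (simp add: inner_commute)
    moreover have "(\<lambda>n. LINT x|?M. \<psi> n x \<bullet> 1) \<longlonglongrightarrow> (LINT x|?M. v x \<bullet> 1)"
      by (rule L2_tendsto_inner[OF L2\<psi>(1) L2v(1) L2_const[OF fin] \<psi>(2)])
    ultimately show ?thesis by (auto intro: LIMSEQ_unique)
  qed
  with H10 show ?thesis unfolding is_torsion_function_def by blast
qed

section \<open>A bump function on a square\<close>

text \<open>The classical flat function exp(-1/t), with a polynomial factor in 1/t so that the class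
  is closed under differentiation.\<close>

definition poly_exp :: "real poly \<Rightarrow> real \<Rightarrow> real" where
  "poly_exp P t = (if t \<le> 0 then 0 else poly P (1 / t) * exp (- (1 / t)))"

text \<open>With u = 1/t, the t-derivative of P(u) exp(-u) is u^2 (P(u) - P'(u)) exp(-u); the list
  \<open>[:0, 0, 1:]\<close> is u^2.\<close>

definition poly_exp_deriv :: "real poly \<Rightarrow> real poly" where
  "poly_exp_deriv P = [:0, 0, 1:] * (P - pderiv P)"

lemma power_exp_minus_le: 
  assumes "0 \<le> (u::real)"
  shows "u ^ n * exp (- u) \<le> fact n"
proof -
  have "(\<Sum>i\<in>{n}. inverse (fact i) *\<^sub>R u ^ i) \<le> (\<Sum>i. inverse (fact i) *\<^sub>R u ^ i)"
    using assms by (intro sum_le_suminf summable_exp_generic) auto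
  then have "u ^ n / fact n \<le> exp u" by (simp add: exp_def field_simps)
  then show ?thesis by (simp add: exp_minus field_simps)
qed

lemma poly_exp_minus_bounded:
  obtains K where "\<And>u. 0 \<le> u \<Longrightarrow> \<bar>poly P u * exp (- u)\<bar> \<le> (K::real)"
proof
  fix u :: real assume u: "0 \<le> u"
  have "\<bar>poly P u * exp (- u)\<bar> \<le> (\<Sum>i\<le>degree P. \<bar>coeff P i\<bar> * (u ^ i * exp (- u)))"
    using u unfolding poly_altdef sum_distrib_right
    by (intro order_trans[OF sum_abs] sum_mono) (simp add: abs_mult)
  also have "\<dots> \<le> (\<Sum>i\<le>degree P. \<bar>coeff P i\<bar> * fact i)"
    using u by (intro sum_mono mult_left_mono power_exp_minus_le) auto
  finally show "\<bar>poly P u * exp (- u)\<bar> \<le> (\<Sum>i\<le>degree P. \<bar>coeff P i\<bar> * fact i)" .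
qed

lemma poly_exp_has_derivative:
  "(poly_exp P has_real_derivative poly_exp (poly_exp_deriv P) t) (at t)"
proof -
  consider "t < 0" | "t = 0" | "0 < t" by linarith
  then show ?thesis
  proof cases
    case 1
    have "((\<lambda>t. 0) has_real_derivative 0) (at t)" by simp
    then have "(poly_exp P has_real_derivative 0) (at t)"
      by (rule DERIV_cong_ev[THEN iffD1, rotated -1, OF _ refl _ refl])
         (use 1 eventually_nhds_in_open[of "{..<0}" t] in \<open>auto elim!: eventually_mono simp: poly_exp_def\<close>)
    with 1 show ?thesis by (simp add: poly_exp_def)
  next
    case 2
    \<comment> \<open>The extra factor u^2 is 1/h^2: boundedness of u^2 P(u) exp(-u) makes the
      function quadratically small at 0, so its difference quotient there is at most
      \<open>K * \<bar>h\<bar>\<close>.\<close>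
    obtain K where K: "\<And>u. 0 \<le> u \<Longrightarrow> \<bar>poly ([:0, 0, 1:] * P) u * exp (- u)\<bar> \<le> K"
      using poly_exp_minus_bounded[of "[:0, 0, 1:] * P"] by blast
    have b: "\<bar>poly_exp P h / h\<bar> \<le> K * \<bar>h\<bar>" for h
    proof (cases "0 < h")
      case True
      have "poly ([:0, 0, 1:] * P) (1 / h) * exp (- (1 / h)) = poly_exp P h / h\<^sup>2"
        using True by (simp add: poly_exp_def power2_eq_square)
      then have "\<bar>poly_exp P h\<bar> / h\<^sup>2 \<le> K" using K[of "1 / h"] True by simp
      then show ?thesis using True by (simp add: field_simps power2_eq_square)
    next
      case False
      have "0 \<le> K" using K[of 0] by simp
      then have "0 \<le> K * \<bar>h\<bar>" by simp
      then show ?thesis using False by (simp add: poly_exp_def del: zero_le_mult_iff)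
    qed
    have "(\<lambda>h. poly_exp P h / h) \<midarrow>0\<rightarrow> 0"
    proof (rule Lim_null_comparison)
      show "\<forall>\<^sub>F h in at 0. norm (poly_exp P h / h) \<le> K * \<bar>h\<bar>" using b by simp
      have "((\<lambda>h::real. K * \<bar>h\<bar>) \<longlongrightarrow> K * \<bar>0\<bar>) (at 0)" by (intro tendsto_intros)
      then show "((\<lambda>h::real. K * \<bar>h\<bar>) \<longlongrightarrow> 0) (at 0)" by simp
    qed
    then show ?thesis using 2 by (simp add: DERIV_def poly_exp_def)
  next
    case 3
    have "((\<lambda>t. poly P (1 / t) * exp (- (1 / t))) has_real_derivative
        poly (poly_exp_deriv P) (1 / t) * exp (- (1 / t))) (at t)"
      using 3 by (auto intro!: derivative_eq_intros poly_DERIV[THEN DERIV_chain2]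
        simp: poly_exp_deriv_def field_simps power2_eq_square)
    then have "(poly_exp P has_real_derivative poly (poly_exp_deriv P) (1 / t) * exp (- (1 / t))) (at t)"
      by (rule DERIV_cong_ev[THEN iffD1, rotated -1, OF _ refl _ refl])
         (use 3 eventually_nhds_in_open[of "{0<..}" t] in \<open>auto elim!: eventually_mono simp: poly_exp_def\<close>)
    with 3 show ?thesis by (simp add: poly_exp_def)
  qed
qed

lemma partial_affine: "partial b (\<lambda>x. x \<bullet> a + c) x = b \<bullet> a"
  by (rule partial_eqI) (auto intro!: derivative_eq_intros)

text \<open>A partial derivative is a constant times a function of the same form with another
  polynomial, so the induction has to range over all \<open>P\<close>.\<close>

lemma C_k_poly_exp: "C_k k (\<lambda>x. poly_exp P (x \<bullet> a + c))"
proof (induction k arbitrary: P)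
  case 0
  have "continuous_on UNIV (poly_exp P)"
    using poly_exp_has_derivative by (meson DERIV_isCont continuous_at_imp_continuous_on)
  then have "continuous_on UNIV (\<lambda>x. poly_exp P (x \<bullet> a + c))"
    by (rule continuous_on_compose2) (auto intro!: continuous_intros)
  then show ?case by simp
next
  case (Suc k)
  have d: "(\<lambda>x. x \<bullet> a + c) differentiable at x" for x by (auto intro!: derivative_intros)
  note chain = partial_chain[OF d poly_exp_has_derivative]
  have "partial b (\<lambda>x. poly_exp P (x \<bullet> a + c)) = (\<lambda>x. poly_exp (poly_exp_deriv P) (x \<bullet> a + c) * (b \<bullet> a))" for b
    by (simp add: fun_eq_iff chain(1) partial_affine)
  then show ?case
    using chain(2) C_k_mult[OF Suc.IH C_k_const] by (simp add: differentiable_on_def)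
qed

text \<open>On (0, 1) this is exp(-1/s - 1/(1-s)), and it is 0 elsewhere. The next two definitions
  are its first and second derivative.\<close>

definition bump :: "real \<Rightarrow> real" where
  "bump s = poly_exp 1 s * poly_exp 1 (1 - s)"

definition bump1 :: "real \<Rightarrow> real" where
  "bump1 s = poly_exp (poly_exp_deriv 1) s * poly_exp 1 (1 - s) - poly_exp 1 s * poly_exp (poly_exp_deriv 1) (1 - s)"

definition bump2 :: "real \<Rightarrow> real" where
  "bump2 s = poly_exp (poly_exp_deriv (poly_exp_deriv 1)) s * poly_exp 1 (1 - s)
    - 2 * (poly_exp (poly_exp_deriv 1) s * poly_exp (poly_exp_deriv 1) (1 - s))
    + poly_exp 1 s * poly_exp (poly_exp_deriv (poly_exp_deriv 1)) (1 - s)"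

lemma poly_exp_reflect_has_derivative:
  "((\<lambda>s. poly_exp P (1 - s)) has_real_derivative - poly_exp (poly_exp_deriv P) (1 - s)) (at s)"
proof -
  have "((\<lambda>s. 1 - s) has_real_derivative - 1) (at s)" by (auto intro!: derivative_eq_intros)
  from DERIV_chain2[where g = "\<lambda>s. 1 - s", OF poly_exp_has_derivative this] show ?thesis by simp
qed

lemma bump_has_derivative: "(bump has_real_derivative bump1 s) (at s)"
  unfolding bump_def[abs_def] bump1_def
  by (auto intro!: derivative_eq_intros poly_exp_has_derivative poly_exp_reflect_has_derivative)

lemma bump1_has_derivative: "(bump1 has_real_derivative bump2 s) (at s)"
  unfolding bump1_def[abs_def] bump2_def
  by (auto intro!: derivative_eq_intros poly_exp_has_derivative poly_exp_reflect_has_derivative)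

lemma bump_zero:
  assumes "s \<notin> {0..1}"
  shows "bump s = 0" "bump2 s = 0"
  using assms by (auto simp: bump_def bump2_def poly_exp_def)

text \<open>All from u^n exp(-u) \<le> n!: the first derivative is u^2 exp(-u), the second (u^4 - 2
  u^3) exp(-u), giving 2! and the crude 4! + 2 * 3! = 36.\<close>

lemma poly_exp_bounds:
  "0 \<le> poly_exp 1 t" "poly_exp 1 t \<le> 1" "\<bar>poly_exp (poly_exp_deriv 1) t\<bar> \<le> 2"
  "\<bar>poly_exp (poly_exp_deriv (poly_exp_deriv 1)) t\<bar> \<le> 36"
proof -
  show "0 \<le> poly_exp 1 t" "poly_exp 1 t \<le> 1" by (auto simp: poly_exp_def)
  have p: "(1 / t) ^ n * exp (- (1 / t)) \<le> fact n" if "0 < t" for n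
    using that by (intro power_exp_minus_le) auto
  have d1: "poly (poly_exp_deriv 1) u = u ^ 2" for u
    by (simp add: poly_exp_deriv_def power2_eq_square)
  have d2: "poly (poly_exp_deriv (poly_exp_deriv 1)) u = u ^ 4 - 2 * u ^ 3" for u
    by (simp add: poly_exp_deriv_def pderiv_pCons algebra_simps power4_eq_xxxx power3_eq_cube)
  show "\<bar>poly_exp (poly_exp_deriv 1) t\<bar> \<le> 2"
    using p[of 2] by (auto simp: poly_exp_def d1 abs_mult fact_numeral)
  have "\<bar>((1/t) ^ 4 - 2 * (1/t) ^ 3) * exp (- (1/t))\<bar> \<le> 36" if "0 < t"
  proof -
    have "((1/t) ^ 4 - 2 * (1/t) ^ 3) * exp (- (1/t)) = (1/t) ^ 4 * exp (- (1/t)) - 2 * ((1/t) ^ 3 * exp (- (1/t)))"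
      by (simp add: algebra_simps)
    moreover have "0 \<le> (1/t) ^ 4 * exp (- (1/t))" "0 \<le> (1/t) ^ 3 * exp (- (1/t))" using that by auto
    moreover have "(1/t) ^ 4 * exp (- (1/t)) \<le> 24" "(1/t) ^ 3 * exp (- (1/t)) \<le> 6"
      using p[OF that, of 4] p[OF that, of 3] by (simp_all add: fact_numeral)
    ultimately show ?thesis unfolding abs_le_iff by linarith
  qed
  then show "\<bar>poly_exp (poly_exp_deriv (poly_exp_deriv 1)) t\<bar> \<le> 36"
    by (simp add: poly_exp_def d2)
qed

lemma bump_bounds: "0 \<le> bump s" "bump s \<le> 1" "\<bar>bump2 s\<bar> \<le> 80"
proof -
  show "0 \<le> bump s" "bump s \<le> 1"
    unfolding bump_def using poly_exp_bounds by (auto intro: mult_le_one)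
  note b = poly_exp_bounds[of s] poly_exp_bounds[of "1 - s"]
  \<comment> \<open>The three terms of the second derivative add up to 36 + 2 * 4 + 36 = 80.\<close>
  have "\<bar>poly_exp (poly_exp_deriv (poly_exp_deriv 1)) s\<bar> * \<bar>poly_exp 1 (1 - s)\<bar> \<le> 36 * 1"
    "\<bar>poly_exp (poly_exp_deriv 1) s\<bar> * \<bar>poly_exp (poly_exp_deriv 1) (1 - s)\<bar> \<le> 2 * 2"
    "\<bar>poly_exp 1 s\<bar> * \<bar>poly_exp (poly_exp_deriv (poly_exp_deriv 1)) (1 - s)\<bar> \<le> 1 * 36"
    using b by (intro mult_mono; simp)+
  then show "\<bar>bump2 s\<bar> \<le> 80"
    unfolding bump2_def abs_mult[symmetric] by linarith
qed

text \<open>1/s + 1/(1-s) is the reciprocal of s(1-s), and s(1-s) is at least 2/9 on the middle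
  third.\<close>

lemma bump_lower:
  assumes "1 / 3 \<le> s" "s \<le> 2 / 3"
  shows "exp (- 9 / 2) \<le> bump s"
proof -
  have "0 \<le> (s - 1 / 3) * (2 / 3 - s)" using assms by simp
  also have "\<dots> = s * (1 - s) - 2 / 9" by (simp add: field_simps)
  finally have "2 / 9 \<le> s * (1 - s)" by simp
  then have "1 / (s * (1 - s)) \<le> 1 / (2 / 9)" using assms by (intro divide_left_mono) auto
  moreover have "1 / s + 1 / (1 - s) = 1 / (s * (1 - s))" using assms by (simp add: field_simps)
  ultimately have "- 9 / 2 \<le> - (1 / s) + - (1 / (1 - s))" by simp
  then have "exp (- 9 / 2) \<le> exp (- (1 / s) + - (1 / (1 - s)))" by simp
  also have "\<dots> = bump s" using assms by (simp only: exp_add) (simp add: bump_def poly_exp_def)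
  finally show ?thesis .
qed

lemma partial_ridge_product:
  assumes d: "\<And>s. (f has_real_derivative f' s) (at s)" and g: "\<And>s. (g has_real_derivative g' s) (at s)"
  shows "partial b (\<lambda>x. f (x \<bullet> a + c) * g (x \<bullet> a' + c')) x =
    f (x \<bullet> a + c) * (g' (x \<bullet> a' + c') * (b \<bullet> a')) + f' (x \<bullet> a + c) * (b \<bullet> a) * g (x \<bullet> a' + c')"
proof -
  have "(\<lambda>x. x \<bullet> a + c) differentiable at x" for a c by (auto intro!: derivative_intros)
  note c1 = partial_chain[OF this d] and c2 = partial_chain[OF this g]
  show ?thesis
    by (subst partial_mult[OF c1(2) c2(2)]) (simp add: c1(1) c2(1) partial_affine)
qed

text \<open>A product of two rescaled bumps. Each second derivative costs 80 / L^2, hence 160 for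
  the Laplacian; the mass is bounded below on the central subsquare.\<close>

lemma square_bump_function:
  fixes p :: "real^2"
  assumes L: "0 < L"
  obtains \<phi> where "\<And>k. C_k k \<phi>" "Cc (cbox p (p + L *\<^sub>R 1)) \<phi>"
    "L\<^sup>2 / (9 * 3 ^ 9) \<le> (LINT x|lborel. \<phi> x)"
    "\<And>x. \<bar>partial (axis 1 1) (partial (axis 1 1) \<phi>) x + partial (axis 2 1) (partial (axis 2 1) \<phi>) x\<bar>
      \<le> 160 / L\<^sup>2 * indicator (cbox p (p + L *\<^sub>R 1)) x"
proof -
  define a c where "a i = (1 / L) *\<^sub>R axis i (1::real)" and "c i = - p $ i / L" for i :: 2
  define s where "s i x = x \<bullet> a i + c i" for i x
  have s_eq: "s i x = (x $ i - p $ i) / L" for i x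
    by (simp add: s_def a_def c_def inner_axis diff_divide_distrib)
  define Q where "Q = cbox p (p + L *\<^sub>R 1)"
  have Q: "x \<in> Q \<longleftrightarrow> s 1 x \<in> {0..1} \<and> s 2 x \<in> {0..1}" for x
    using L by (auto simp: Q_def s_eq mem_box_cart forall_2 field_simps)
  define \<phi> where "\<phi> x = bump (s 1 x) * bump (s 2 x)" for x
  have smooth: "C_k k (\<lambda>x. bump (s i x))" for k i
  proof -
    have "(\<lambda>x. poly_exp 1 (1 - s i x)) = (\<lambda>x. poly_exp 1 (x \<bullet> (- a i) + (1 - c i)))"
      by (simp add: s_def algebra_simps)
    then have "C_k k (\<lambda>x. poly_exp 1 (1 - s i x))" by (simp only: C_k_poly_exp)
    then show ?thesis
      unfolding bump_def by (rule C_k_mult[rotated]) (simp only: s_def C_k_poly_exp)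
  qed
  have C: "C_k k \<phi>" for k unfolding \<phi>_def[abs_def] by (intro C_k_mult smooth)
  have zero: "\<phi> x = 0" if "x \<notin> Q" for x
    using that by (auto simp: Q \<phi>_def bump_zero)
  have Cc: "Cc Q \<phi>"
    using zero C[of 0] unfolding Cc_def by (auto intro!: exI[of _ Q] simp: Q_def)
  have ax: "axis 1 1 \<bullet> a 1 = 1 / L" "axis 1 1 \<bullet> a 2 = 0" "axis 2 1 \<bullet> a 2 = 1 / L" "axis 2 1 \<bullet> a 1 = 0"
    by (simp_all add: a_def inner_axis_axis)
  note pb = partial_ridge_product[where a = "a 1" and c = "c 1" and a' = "a 2" and c' = "c 2", folded s_def]
  have "partial (axis 1 1) \<phi> = (\<lambda>x. 1 / L * (bump1 (s 1 x) * bump (s 2 x)))"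
    unfolding \<phi>_def[abs_def] pb[OF bump_has_derivative bump_has_derivative] by (simp add: ax)
  moreover have "partial (axis 1 1) (\<lambda>x. 1 / L * (bump1 (s 1 x) * bump (s 2 x))) x
      = 1 / L\<^sup>2 * (bump2 (s 1 x) * bump (s 2 x))" for x
  proof -
    have "((\<lambda>y. 1 / L * bump1 y) has_real_derivative 1 / L * bump2 y) (at y)" for y
      by (intro DERIV_cmult bump1_has_derivative)
    from pb[OF this bump_has_derivative] show ?thesis
      by (simp add: ax mult.assoc power2_eq_square)
  qed
  ultimately have d1: "partial (axis 1 1) (partial (axis 1 1) \<phi>) x = 1 / L\<^sup>2 * (bump2 (s 1 x) * bump (s 2 x))" for x
    by simp
  have "partial (axis 2 1) \<phi> = (\<lambda>x. 1 / L * (bump (s 1 x) * bump1 (s 2 x)))"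
    unfolding \<phi>_def[abs_def] pb[OF bump_has_derivative bump_has_derivative] by (simp add: ax)
  moreover have "partial (axis 2 1) (\<lambda>x. 1 / L * (bump (s 1 x) * bump1 (s 2 x))) x
      = 1 / L\<^sup>2 * (bump (s 1 x) * bump2 (s 2 x))" for x
  proof -
    have "((\<lambda>y. 1 / L * bump y) has_real_derivative 1 / L * bump1 y) (at y)" for y
      by (intro DERIV_cmult bump_has_derivative)
    from pb[OF this bump1_has_derivative] show ?thesis
      by (simp add: ax mult.assoc power2_eq_square)
  qed
  ultimately have d2: "partial (axis 2 1) (partial (axis 2 1) \<phi>) x = 1 / L\<^sup>2 * (bump (s 1 x) * bump2 (s 2 x))" for x
    by simp
  have lap: "\<bar>partial (axis 1 1) (partial (axis 1 1) \<phi>) x + partial (axis 2 1) (partial (axis 2 1) \<phi>) x\<bar>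
      \<le> 160 / L\<^sup>2 * indicator Q x" for x
  proof (cases "x \<in> Q")
    case True
    have "\<bar>bump2 (s 1 x)\<bar> * bump (s 2 x) \<le> 80 * 1" "bump (s 1 x) * \<bar>bump2 (s 2 x)\<bar> \<le> 1 * 80"
      using bump_bounds by (intro mult_mono; simp)+
    then have "\<bar>bump2 (s 1 x) * bump (s 2 x) + bump (s 1 x) * bump2 (s 2 x)\<bar> \<le> 160"
      using abs_triangle_ineq[of "bump2 (s 1 x) * bump (s 2 x)" "bump (s 1 x) * bump2 (s 2 x)"]
      by (simp add: abs_mult bump_bounds)
    then have "1 / L\<^sup>2 * \<bar>bump2 (s 1 x) * bump (s 2 x) + bump (s 1 x) * bump2 (s 2 x)\<bar> \<le> 1 / L\<^sup>2 * 160"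
      by (intro mult_left_mono) auto
    then show ?thesis using True unfolding d1 d2 by (simp add: abs_mult flip: distrib_left add_divide_distrib)
  next
    case False
    then show ?thesis unfolding d1 d2 by (auto simp: Q bump_zero)
  qed
  \<comment> \<open>The central ninth of the square, where both factors are at least exp(-9/2);
    their product exp(-9) is replaced by 3^-9.\<close>
  define R where "R = cbox (p + (L / 3) *\<^sub>R 1) (p + (2 * L / 3) *\<^sub>R (1 :: real^2))"
  have "measure lborel R = (L / 3)\<^sup>2"
    unfolding R_def using L
    by (subst content_cbox_cart) (auto simp: interval_eq_empty_cart UNIV_2 power2_eq_square)
  then have "L\<^sup>2 / (9 * 3 ^ 9) = (LINT x|lborel. 1 / 3 ^ 9 * indicator R x)"
    by (simp add: power_divide)
  also have "\<dots> \<le> (LINT x|lborel. \<phi> x)"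
  proof (rule integral_mono)
    show "integrable lborel (\<lambda>x. 1 / 3 ^ 9 * indicator R x :: real)"
      unfolding R_def by (intro integrable_mult_right integrable_real_indicator) (use emeasure_compact_finite[OF compact_cbox] in auto)
    show "integrable lborel \<phi>" using Cc by (rule Cc_integrable_lborel)
    have e: "1 / 3 ^ 9 \<le> exp (- 9 / 2) * exp (- 9 / 2 :: real)"
    proof -
      have "exp (9::real) = exp 1 ^ 9" by (simp flip: exp_of_nat_mult)
      also have "\<dots> \<le> 3 ^ 9" using exp_le by (intro power_mono) auto
      finally have "1 / 3 ^ 9 \<le> 1 / exp (9::real)" by (intro divide_left_mono) auto
      then show ?thesis by (simp add: exp_minus inverse_eq_divide flip: exp_add)
    qed
    show "1 / 3 ^ 9 * indicator R x \<le> \<phi> x" for x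
    proof (cases "x \<in> R")
      case True
      then have "1 / 3 \<le> s i x \<and> s i x \<le> 2 / 3" for i
        using L by (auto simp: R_def s_eq mem_box_cart field_simps)
      then have "exp (- 9 / 2) * exp (- 9 / 2 :: real) \<le> \<phi> x"
        unfolding \<phi>_def by (intro mult_mono bump_lower) (auto simp: bump_bounds)
      with True e show ?thesis by simp
    qed (simp add: \<phi>_def bump_bounds)
  qed
  finally show ?thesis using that[OF C] Cc lap by (simp add: Q_def)
qed

section \<open>Bounds for the constants\<close>

lemma summable_Bessel_terms: "summable (\<lambda>k. (y::real) ^ k / (fact k)\<^sup>2)"
proof (rule summable_comparison_test')
  show "summable (\<lambda>k. \<bar>y\<bar> ^ k / fact k)"
    using summable_exp[of "\<bar>y\<bar>"] by (simp add: field_simps)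
  fix k :: nat
  have "(1::real) \<le> fact k" by (rule fact_ge_1)
  then have "(fact k :: real) \<le> (fact k)\<^sup>2" by (simp add: power2_eq_square)
  then show "norm (y ^ k / (fact k)\<^sup>2) \<le> \<bar>y\<bar> ^ k / fact k"
    by (auto simp: power_abs intro!: divide_left_mono)
qed

lemma Bessel_J0_eq: "Bessel_J0 x = (\<Sum>k. 1 / (fact k)\<^sup>2 * (- (x\<^sup>2 / 4)) ^ k)"
  unfolding Bessel_J0_def
  by (intro suminf_cong) (simp add: power_mult power_divide power_minus[of "x\<^sup>2 / 4"])

lemma isCont_Bessel_J0: "isCont Bessel_J0 x"
proof -
  define K where "K = x\<^sup>2 / 4 + 1"
  have "isCont (\<lambda>y. \<Sum>k. 1 / (fact k)\<^sup>2 * y ^ k) (- (x\<^sup>2 / 4))"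
  proof (rule isCont_powser)
    show "summable (\<lambda>k. 1 / (fact k)\<^sup>2 * K ^ k)" using summable_Bessel_terms[of K] by simp
    show "norm (- (x\<^sup>2 / 4)) < norm K" by (simp add: K_def)
  qed
  moreover have "isCont (\<lambda>x. - (x\<^sup>2 / 4)) x" by (intro continuous_intros) simp
  ultimately have "isCont (\<lambda>x. \<Sum>k. 1 / (fact k)\<^sup>2 * (- (x\<^sup>2 / 4)) ^ k) x"
    by (rule isCont_o2[rotated])
  then show ?thesis using Bessel_J0_eq by presburger
qed

lemma Bessel_J0_split: 
  "Bessel_J0 x = (\<Sum>k<n. 1 / (fact k)\<^sup>2 * (- (x\<^sup>2 / 4)) ^ k) + (\<Sum>k. 1 / (fact (k + n))\<^sup>2 * (- (x\<^sup>2 / 4)) ^ (k + n))"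
proof -
  have s: "summable (\<lambda>k. 1 / (fact k)\<^sup>2 * (- (x\<^sup>2 / 4)) ^ k)"
    using summable_Bessel_terms[of "- (x\<^sup>2 / 4)"] by simp
  show "Bessel_J0 x = (\<Sum>k<n. 1 / (fact k)\<^sup>2 * (- (x\<^sup>2 / 4)) ^ k) + (\<Sum>k. 1 / (fact (k + n))\<^sup>2 * (- (x\<^sup>2 / 4)) ^ (k + n))"
    unfolding Bessel_J0_eq using suminf_split_initial_segment[OF s, of n] by simp
qed

text \<open>Writing y = x^2/4, consecutive terms have ratio y / (k + n + 1)^2, at most 1/2 in this
  range, so the tail is at most twice its first term.\<close>

lemma Bessel_J0_tail:
  assumes y: "x\<^sup>2 / 4 \<le> real (Suc n) / 2"
  shows "\<bar>\<Sum>k. 1 / (fact (k + n))\<^sup>2 * (- (x\<^sup>2 / 4)) ^ (k + n)\<bar> \<le> 2 * (x\<^sup>2 / 4) ^ n / (fact n)\<^sup>2"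
proof -
  define y a where "y = x\<^sup>2 / 4" and "a = y ^ n / (fact n)\<^sup>2"
  have y0: "0 \<le> y" "y \<le> real (Suc n) / 2" using y by (simp_all add: y_def)
  have b: "norm (1 / (fact (k + n))\<^sup>2 * (- y) ^ (k + n)) \<le> a * (1/2) ^ k" for k
  proof (induction k)
    case 0
    then show ?case using y0 by (simp add: a_def power_abs)
  next
    case (Suc k)
    have "norm (1 / (fact (Suc k + n))\<^sup>2 * (- y) ^ (Suc k + n))
      = norm (1 / (fact (k + n))\<^sup>2 * (- y) ^ (k + n)) * (y / (real (Suc (k + n)))\<^sup>2)"
      using y0 by (simp add: abs_mult power_mult_distrib field_simps power_abs del: of_nat_Suc)
    also have "\<dots> \<le> a * (1/2) ^ k * (1/2)"
    proof (intro mult_mono Suc.IH)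
      have "y / (real (Suc (k + n)))\<^sup>2 \<le> (real (Suc (k + n)) / 2) / (real (Suc (k + n)))\<^sup>2"
        using y0 by (intro divide_right_mono) auto
      also have "\<dots> \<le> 1 / 2" by (simp add: power2_eq_square)
      finally show "y / (real (Suc (k + n)))\<^sup>2 \<le> 1 / 2" .
    qed (use y0 in \<open>auto simp: a_def\<close>)
    finally show ?case by simp
  qed
  have "norm (\<Sum>k. 1 / (fact (k + n))\<^sup>2 * (- y) ^ (k + n)) \<le> (\<Sum>k. a * (1/2) ^ k)"
    by (rule norm_suminf_le[OF b]) (intro summable_mult summable_geometric, simp)
  also have "\<dots> = 2 * a" by (subst suminf_mult) (auto simp: suminf_geometric intro: summable_geometric)
  finally show ?thesis by (simp add: y_def a_def)
qed

text \<open>\<open>LEAST\<close> says something only if a least zero exists. A sign change gives a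
  zero, positivity on [0, 1) keeps the zeros away from 0, and continuity makes their set
  closed.\<close>

lemma j0_ge_1: "1 \<le> j0"
proof -
  have "isCont Bessel_J0 x" for x by (rule isCont_Bessel_J0)
  then have cont: "continuous_on UNIV Bessel_J0" by (simp add: continuous_at_imp_continuous_on)
  have pos: "Bessel_J0 x > 0" if "0 \<le> x" "x < 1" for x
  proof -
    have "x\<^sup>2 < 1" using that by (simp add: abs_square_less_1)
    then show ?thesis
      using Bessel_J0_split[of x 1] Bessel_J0_tail[of x 1] by simp
  qed
  \<comment> \<open>Six terms are summed exactly; here x^2/4 = 9/4 is below the limit 7/2 of the
    tail estimate.\<close>
  have "Bessel_J0 3 < 0"
    using Bessel_J0_split[of 3 6] Bessel_J0_tail[of 3 6]
    by (simp add: lessThan_nat_numeral lessThan_Suc fact_numeral power_divide)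
  moreover have "0 < Bessel_J0 0" by (rule pos) auto
  ultimately obtain z where z: "0 \<le> z" "Bessel_J0 z = 0"
    using IVT2'[of Bessel_J0 3 0 0] cont by (auto intro: continuous_on_subset)
  \<comment> \<open>With \<open>1 \<le> x\<close> in place of \<open>0 < x\<close> the set is
    visibly closed, and it has the same elements.\<close>
  define Z where "Z = {x. 1 \<le> x \<and> Bessel_J0 x = 0}"
  have Zeq: "x \<in> Z \<longleftrightarrow> 0 < x \<and> Bessel_J0 x = 0" for x
    using pos[of x] by (cases "x < 1") (auto simp: Z_def)
  have "closed Z"
  proof -
    have "Z = {1..} \<inter> Bessel_J0 -` {0}" by (auto simp: Z_def)
    then show ?thesis
      using cont by (auto intro!: closed_Int closed_vimage simp: continuous_on_eq_continuous_at)
  qed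
  moreover have "z \<in> Z" using z pos[of z] by (cases "z < 1") (auto simp: Z_def)
  then have "Z \<noteq> {}" by blast
  moreover have bdd: "bdd_below Z" by (auto simp: Z_def bdd_below_def)
  ultimately have "Inf Z \<in> Z" by (intro closed_contains_Inf)
  moreover have "Inf Z \<le> x" if "x \<in> Z" for x using that bdd by (rule cInf_lower)
  ultimately have "j0 = Inf Z"
    unfolding j0_def using Zeq by (intro Least_equality) auto
  with \<open>Inf Z \<in> Z\<close> show ?thesis by (simp add: Z_def)
qed

text \<open>\<open>GREATEST\<close> requires that the maximum is attained. The function is positive
  somewhere and tends to 0, so a compact interval suffices. As ln 2 \<ge> 2/3, the left end
  \<open>a\<close> is at least 3, and dropping the numerator gives 3^-9.\<close>

lemma c1_bounds: "0 \<le> c1" "c1 \<le> 1 / 3 ^ 9"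
proof -
  define f where "f c = (1 - 2 powr (9 / 2) * exp (- c)) ^ 7 / c ^ 9" for c :: real
  define a where "a = 9 / 2 * ln (2::real)"
  have a: "3 \<le> a" using ln2_ge_two_thirds by (simp add: a_def)
  have p: "2 powr (9 / 2) = exp a" by (simp add: a_def powr_def)
  have fa: "f a = 0" by (simp add: f_def p flip: exp_add)
  have f0: "0 \<le> f c" if "a \<le> c" for c
    using that a by (auto simp: f_def p simp flip: exp_add)
  have f1: "f c \<le> 1 / c ^ 9" if "a \<le> c" for c
    unfolding f_def using that a
    by (intro divide_right_mono power_le_one) (auto simp: p simp flip: exp_add)
  have cont: "continuous_on {a..b} f" for b
    unfolding f_def using a by (intro continuous_intros) auto
  obtain c0 where c0: "a \<le> c0" "\<And>c. a \<le> c \<Longrightarrow> f c \<le> f c0"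
  proof -
    define b where "b = a + 1"
    have fb: "0 < f b"
      using a by (auto simp: f_def b_def p intro!: divide_pos_pos zero_less_power simp flip: exp_add)
    \<comment> \<open>Beyond \<open>R\<close> the function is below 1/y, hence below its value at
      \<open>b\<close>.\<close>
    define R where "R = max b (1 / f b)"
    have R: "1 \<le> R" "b \<le> R" using a by (auto simp: R_def b_def)
    have "\<exists>x\<in>{a..R}. \<forall>y\<in>{a..R}. f y \<le> f x"
      using cont R by (intro continuous_attains_sup) (auto simp: b_def)
    then obtain x where x: "a \<le> x" "\<And>y. a \<le> y \<Longrightarrow> y \<le> R \<Longrightarrow> f y \<le> f x" by auto
    have "f y \<le> f x" if "a \<le> y" for y
    proof (cases "y \<le> R")
      case True
      then show ?thesis using x that by blast
    next
      case False
      have "f y \<le> 1 / y ^ 9" using that by (rule f1)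
      also have "\<dots> \<le> 1 / y"
        using False R self_le_power[of y 9] by (intro divide_left_mono) auto
      also have "\<dots> \<le> 1 / (1 / f b)"
        using False R fb by (intro divide_left_mono) (auto simp: R_def)
      also have "\<dots> = f b" by simp
      also have "\<dots> \<le> f x" using x R by (auto simp: b_def)
      finally show ?thesis .
    qed
    with x(1) show ?thesis by (rule that)
  qed
  have "c1 = f c0"
    unfolding c1_def using c0 by (intro Greatest_equality) (auto simp: f_def a_def)
  moreover have "f c0 \<le> 1 / c0 ^ 9" using c0(1) by (rule f1)
  moreover have "1 / c0 ^ 9 \<le> 1 / 3 ^ 9"
    using a c0(1) by (intro divide_left_mono power_mono) auto
  ultimately show "0 \<le> c1" "c1 \<le> 1 / 3 ^ 9" using f0[OF c0(1)] by linarith+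
qed

text \<open>The first factor is 1 - A with A \<le> 3 * 10^-12, the second at least 1 - B with B
  \<le> 2 * 10^-12; a gap of 10^-11 is thus more than enough.\<close>

lemma ratio_bound_lower:
  "1 - 1 / 10 ^ 11 < (1 - 3 ^ 4 / (12801 * 2 ^ 31 * (1 + (pi + pi ^ 2) / 16) ^ 4)) *
    inverse (1 + 3 ^ 5 * (67 - 44 * sqrt 2) / (2 ^ 34 * 5 * 7 * j0) * c1)"
proof -
  define A B where "A = 3 ^ 4 / (12801 * 2 ^ 31 * (1 + (pi + pi ^ 2) / 16) ^ 4)"
    and "B = 3 ^ 5 * (67 - 44 * sqrt 2) / (2 ^ 34 * 5 * 7 * j0) * c1"
  define P where "P = (1 + (pi + pi ^ 2) / 16) ^ 4"
  have P: "1 \<le> P"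
    unfolding P_def by (intro one_le_power) (simp add: add_nonneg_nonneg pi_ge_zero)
  have "A \<le> 3 ^ 4 / (12801 * 2 ^ 31 * 1)"
    unfolding A_def P_def[symmetric] using P by (intro divide_left_mono mult_left_mono) auto
  then have A: "A \<le> 3 / 10 ^ 12" by simp
  have A0: "0 \<le> A" by (simp add: A_def)
  have s: "1 \<le> sqrt 2" "sqrt 2 \<le> 3 / 2" by (simp, rule real_le_lsqrt) (auto simp: power2_eq_square)
  have "3 ^ 5 * (67 - 44 * sqrt 2) / (2 ^ 34 * 5 * 7 * j0) \<le> 3 ^ 5 * 67 / (2 ^ 34 * 5 * 7 * 1)"
    using s j0_ge_1 by (intro frac_le mult_left_mono) auto
  then have "B \<le> 3 ^ 5 * 67 / (2 ^ 34 * 5 * 7 * 1) * (1 / 3 ^ 9)"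
    unfolding B_def using c1_bounds by (intro mult_mono) auto
  then have B: "B \<le> 2 / 10 ^ 12" by simp
  have B0: "0 \<le> B" unfolding B_def using s j0_ge_1 c1_bounds by simp
  have "1 - B \<le> inverse (1 + B)"
  proof -
    have "(1 - B) * (1 + B) \<le> 1" by (simp add: algebra_simps)
    then show ?thesis using B0 by (simp add: field_simps)
  qed
  then have "(1 - A) * (1 - B) \<le> (1 - A) * inverse (1 + B)"
    using A by (intro mult_left_mono) auto
  moreover have "1 - A - B \<le> (1 - A) * (1 - B)" using A0 B0 by (simp add: algebra_simps)
  moreover have "A + B < 1 / 10 ^ 11" using A B by simp
  ultimately have "1 - 1 / 10 ^ 11 < (1 - A) * inverse (1 + B)" by linarith
  then show ?thesis by (simp only: A_def B_def)
qed

section \<open>The mean to max ratio\<close>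

lemma Basis_real_2: "(Basis :: (real^2) set) = {axis 1 1, axis 2 1}"
  by (auto simp: Basis_vec_def UNIV_2)

text \<open>The constant is the Laplacian bound 160 times the reciprocal 9 * 3^9 of the mass of the
  bump at unit scale.\<close>

lemma square_in_domain_bound:
  fixes \<Omega> :: "(real^2) set"
  assumes \<Omega>: "open \<Omega>" "emeasure lebesgue \<Omega> < \<infinity>"
    and wg: "in_H10 \<Omega> w g"
    and weak: "\<And>v h. in_H10 \<Omega> v h \<Longrightarrow> (LINT x|lebesgue_on \<Omega>. g x \<bullet> h x) = (LINT x|lebesgue_on \<Omega>. v x)"
    and bound: "AE x in lebesgue_on \<Omega>. \<bar>w x\<bar> \<le> M"
    and L: "0 < L" and sub: "cbox p (p + L *\<^sub>R 1) \<subseteq> \<Omega>"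
  shows "L\<^sup>2 \<le> 1440 * 3 ^ 9 * M"
proof -
  let ?M = "lebesgue_on \<Omega>"
  define Q where "Q = cbox p (p + L *\<^sub>R 1)"
  obtain \<phi> where \<phi>: "\<And>k. C_k k \<phi>" "Cc Q \<phi>" "L\<^sup>2 / (9 * 3 ^ 9) \<le> (LINT x|lborel. \<phi> x)"
    "\<And>x. \<bar>partial (axis 1 1) (partial (axis 1 1) \<phi>) x + partial (axis 2 1) (partial (axis 2 1) \<phi>) x\<bar>
      \<le> 160 / L\<^sup>2 * indicator Q x"
    using square_bump_function[OF L, of p] unfolding Q_def by blast
  have t: "test_function \<Omega> \<phi>"
    using \<phi>(1) Cc_mono[OF \<phi>(2), of \<Omega>] sub by (intro test_functionI) (auto simp: Q_def)
  have L2: "L2 ?M w" "L2 ?M g" and hwg: "has_weak_gradient \<Omega> w g"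
    using wg by (auto simp: in_H10_def in_H1_def in_L2_iff)
  have axes: "axis 1 1 \<in> (Basis :: (real^2) set)" "axis 2 1 \<in> (Basis :: (real^2) set)"
    by (simp_all add: Basis_real_2)
  define d where "d b = partial b (partial b \<phi>)" for b
  \<comment> \<open>The definition of the weak gradient is applied to the test function
    \<open>partial b \<phi>\<close>, which moves the remaining derivative off
    \<open>w\<close>.\<close>
  have parts: "(LINT x|?M. w x * d b x) = - (LINT x|?M. partial b \<phi> x * (g x \<bullet> b))" if "b \<in> Basis" for b
    using weak_gradient_componentwise[OF \<Omega>(1) L2 test_function_partial[OF t that]] hwg
      test_function_partial[OF t that] that by (auto simp: has_weak_gradient_def d_def)
  have L2d: "L2 ?M (d b)" "L2 ?M (partial b \<phi>)" if "b \<in> Basis" for b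
    using L2_test_function(1)[OF \<Omega>(1)] test_function_partial[OF t that]
      test_function_partial[OF test_function_partial[OF t that] that] by (auto simp: d_def)
  have int1: "integrable ?M (\<lambda>x. w x * d b x)" if "b \<in> Basis" for b
    using L2_integrable_inner[OF L2(1) L2d(1)[OF that]] by simp
  have int2: "integrable ?M (\<lambda>x. partial b \<phi> x * (g x \<bullet> b))" if "b \<in> Basis" for b
  proof -
    have "L2 ?M (\<lambda>x. partial b \<phi> x *\<^sub>R b)"
      using L2d(2)[OF that] by (auto simp: L2_def power_mult_distrib)
    from L2_integrable_inner[OF this L2(2)] show ?thesis by (simp add: inner_commute)
  qed
  have ig: "g x \<bullet> grad \<phi> x = partial (axis 1 1) \<phi> x * (g x \<bullet> axis 1 1) + partial (axis 2 1) \<phi> x * (g x \<bullet> axis 2 1)" for x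
    unfolding grad_def Basis_real_2 by (simp add: axis_eq_axis inner_add_right)
  have "L\<^sup>2 / (9 * 3 ^ 9) \<le> (LINT x|?M. \<phi> x)"
    using \<phi>(3) Cc_integral[OF \<Omega>(1) test_function_Cc[OF t]] by simp
  also have "\<dots> = (LINT x|?M. g x \<bullet> grad \<phi> x)"
    using weak[OF test_function_in_H10[OF \<Omega>(1) t]] by simp
  also have "\<dots> = (LINT x|?M. partial (axis 1 1) \<phi> x * (g x \<bullet> axis 1 1)) + (LINT x|?M. partial (axis 2 1) \<phi> x * (g x \<bullet> axis 2 1))"
    unfolding ig by (rule Bochner_Integration.integral_add[OF int2[OF axes(1)] int2[OF axes(2)]])
  also have "\<dots> = - ((LINT x|?M. w x * d (axis 1 1) x) + (LINT x|?M. w x * d (axis 2 1) x))"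
    using parts[OF axes(1)] parts[OF axes(2)] by simp
  also have "(LINT x|?M. w x * d (axis 1 1) x) + (LINT x|?M. w x * d (axis 2 1) x)
      = (LINT x|?M. w x * d (axis 1 1) x + w x * d (axis 2 1) x)"
    by (rule Bochner_Integration.integral_add[symmetric, OF int1[OF axes(1)] int1[OF axes(2)]])
  also have "- \<dots> \<le> \<bar>LINT x|?M. w x * d (axis 1 1) x + w x * d (axis 2 1) x\<bar>" by simp
  also have "\<dots> \<le> (LINT x|?M. \<bar>w x * d (axis 1 1) x + w x * d (axis 2 1) x\<bar>)"
    by (rule integral_abs_bound)
  also have "\<dots> \<le> (LINT x|?M. M * 160 / L\<^sup>2 * indicator Q x)"
  proof (rule integral_mono_AE)
    have "Q \<inter> \<Omega> = Q" using sub by (auto simp: Q_def)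
    have h: "(\<lambda>x. M * 160 / L\<^sup>2 * indicator Q x) \<in> borel_measurable borel" unfolding Q_def by measurable
    have "integrable lborel (\<lambda>x. M * 160 / L\<^sup>2 * indicator Q x)"
      unfolding Q_def
      by (intro integrable_mult_right integrable_real_indicator) (use emeasure_compact_finite[OF compact_cbox] in auto)
    then show "integrable ?M (\<lambda>x. M * 160 / L\<^sup>2 * indicator Q x)"
      using integral_lebesgue_on_eq_lborel(2)[OF \<Omega>(1) h] sub by (auto simp: Q_def indicator_def)
    show "AE x in ?M. \<bar>w x * d (axis 1 1) x + w x * d (axis 2 1) x\<bar> \<le> M * 160 / L\<^sup>2 * indicator Q x"
      using bound
    proof eventually_elim
      fix x assume "\<bar>w x\<bar> \<le> M"
      have "\<bar>w x * d (axis 1 1) x + w x * d (axis 2 1) x\<bar> = \<bar>w x\<bar> * \<bar>d (axis 1 1) x + d (axis 2 1) x\<bar>"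
        by (simp flip: abs_mult distrib_left)
      also have "\<dots> \<le> M * (160 / L\<^sup>2 * indicator Q x)"
        using \<open>\<bar>w x\<bar> \<le> M\<close> \<phi>(4)[of x] by (intro mult_mono) (auto simp: d_def)
      finally show "\<bar>w x * d (axis 1 1) x + w x * d (axis 2 1) x\<bar> \<le> M * 160 / L\<^sup>2 * indicator Q x" by simp
    qed
  qed (intro integrable_abs Bochner_Integration.integrable_add int1 axes)
  also have "\<dots> = (LINT x|lborel. M * 160 / L\<^sup>2 * indicator Q x)"
    using sub by (intro integral_lebesgue_on_eq_lborel(1)[OF \<Omega>(1)]) (auto simp: Q_def indicator_def)
  also have "\<dots> = M * 160 / L\<^sup>2 * L\<^sup>2"
  proof -
    have "measure lborel Q = L\<^sup>2"
      unfolding Q_def using L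
      by (subst content_cbox_cart) (auto simp: interval_eq_empty_cart UNIV_2 power2_eq_square)
    then show ?thesis by simp
  qed
  finally show ?thesis using L by (simp add: field_simps)
qed

text \<open>With \<delta> = M - |w| the cosine equals sin(a \<delta>), at most a \<delta> in
  modulus. Since a M \<le> 2 and \<delta> \<le> M, its square is bounded linearly in \<delta>, and
  so integrates to the deficit of the mean. The double angle formula gives the second bound.\<close>

lemma cos_quarter_period_le:
  assumes "0 < M" "\<bar>w\<bar> \<le> M"
  shows "(cos (pi / (2 * M) * w))\<^sup>2 \<le> 4 / M * (M - \<bar>w\<bar>)"
    and "(sin (2 * (pi / (2 * M)) * w))\<^sup>2 \<le> 16 / M * (M - \<bar>w\<bar>)"
proof -
  define a where "a = pi / (2 * M)"
  have aM: "a * M = pi / 2" using assms by (simp add: a_def)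
  have a: "0 < a" "a * M \<le> 2" using assms pi_less_4 aM by (auto simp: a_def)
  define \<delta> where "\<delta> = M - \<bar>w\<bar>"
  have \<delta>: "0 \<le> \<delta>" "\<delta> \<le> M" using assms by (auto simp: \<delta>_def)
  have key: "(a * \<delta>)\<^sup>2 \<le> 4 / M * \<delta>"
  proof -
    have "(a * \<delta>)\<^sup>2 = (a * M)\<^sup>2 * (\<delta> * \<delta>) / M\<^sup>2"
      using assms by (simp add: power2_eq_square)
    also have "\<dots> \<le> 2\<^sup>2 * (M * \<delta>) / M\<^sup>2"
      using a \<delta> assms by (intro divide_right_mono mult_mono power_mono) auto
    also have "\<dots> = 4 / M * \<delta>" using assms by (simp add: power2_eq_square)
    finally show ?thesis .
  qed
  have "cos (a * w) = cos (a * \<bar>w\<bar>)" by (cases "w \<ge> 0") auto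
  also have "a * \<bar>w\<bar> = pi / 2 - a * \<delta>" using aM by (simp add: \<delta>_def algebra_simps)
  finally have "cos (a * w) = sin (a * \<delta>)" by (simp add: cos_diff)
  moreover have "(sin (a * \<delta>))\<^sup>2 \<le> (a * \<delta>)\<^sup>2"
    using abs_sin_x_le_abs_x[of "a * \<delta>"] by (simp add: abs_le_square_iff)
  ultimately show c: "(cos (pi / (2 * M) * w))\<^sup>2 \<le> 4 / M * (M - \<bar>w\<bar>)"
    using key unfolding a_def[symmetric] \<delta>_def[symmetric] by simp
  have "(sin (2 * a * w))\<^sup>2 = 4 * ((sin (a * w))\<^sup>2 * (cos (a * w))\<^sup>2)"
    using sin_double[of "a * w"] by (simp add: power_mult_distrib mult.assoc)
  also have "(sin (a * w))\<^sup>2 * (cos (a * w))\<^sup>2 \<le> 1 * (cos (a * w))\<^sup>2"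
    by (intro mult_right_mono) (auto simp: abs_square_le_1)
  finally have "(sin (2 * a * w))\<^sup>2 \<le> 4 * (4 / M * (M - \<bar>w\<bar>))"
    using c unfolding a_def[symmetric] by linarith
  then show "(sin (2 * (pi / (2 * M)) * w))\<^sup>2 \<le> 16 / M * (M - \<bar>w\<bar>)"
    unfolding a_def[symmetric] by simp
qed

text \<open>Sine and cosine are 1-Lipschitz, so replacing an approximating test function by
  \<open>w\<close> costs a factor 2 and a multiple of the L^2 error.\<close>

lemma trig_perturbation:
  "(cos (a * s))\<^sup>2 \<le> 2 * (cos (a * t))\<^sup>2 + 2 * a\<^sup>2 * (s - t)\<^sup>2"
  "(sin (a * s))\<^sup>2 \<le> 2 * (sin (a * t))\<^sup>2 + 2 * a\<^sup>2 * (s - t :: real)\<^sup>2"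
proof -
  have gen: "(f (a * s))\<^sup>2 \<le> 2 * (f (a * t))\<^sup>2 + 2 * a\<^sup>2 * (s - t)\<^sup>2"
    if "\<bar>f (a * s) - f (a * t)\<bar> \<le> \<bar>a * s - a * t\<bar>" for f :: "real \<Rightarrow> real"
  proof -
    have "(f (a * s) - f (a * t))\<^sup>2 \<le> (a * s - a * t)\<^sup>2"
      using that by (simp add: abs_le_square_iff)
    also have "\<dots> = a\<^sup>2 * (s - t)\<^sup>2" by (simp add: power2_eq_square algebra_simps)
    finally show ?thesis
      using power2_norm_add_le[of "f (a * t)" "f (a * s) - f (a * t)"] by simp
  qed
  have lip: "\<bar>f x - f y\<bar> \<le> \<bar>x - y\<bar>"
    if "\<And>t. (f has_real_derivative f' t) (at t)" "\<And>t. \<bar>f' t\<bar> \<le> 1" for f f' :: "real \<Rightarrow> real" and x y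
    using field_differentiable_bound[of UNIV f f' 1 y x] that by simp
  show "(cos (a * s))\<^sup>2 \<le> 2 * (cos (a * t))\<^sup>2 + 2 * a\<^sup>2 * (s - t)\<^sup>2"
    by (rule gen, rule lip[OF DERIV_cos]) simp
  show "(sin (a * s))\<^sup>2 \<le> 2 * (sin (a * t))\<^sup>2 + 2 * a\<^sup>2 * (s - t)\<^sup>2"
    by (rule gen, rule lip[OF DERIV_sin]) simp
qed

lemma torsion_mean_bound:
  fixes \<Omega> :: "(real^2) set"
  assumes \<Omega>: "open \<Omega>" "emeasure lebesgue \<Omega> < \<infinity>" "simply_connected \<Omega>"
    and w: "is_torsion_function \<Omega> w"
    and bound: "AE x in lebesgue_on \<Omega>. \<bar>w x\<bar> \<le> M" and M: "0 < M"
  shows "(LINT x|lebesgue_on \<Omega>. \<bar>w x\<bar>) \<le> (1 - 1 / 10 ^ 11) * M * measure lebesgue \<Omega>"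
proof -
  let ?M = "lebesgue_on \<Omega>"
  interpret finite_measure ?M using \<Omega>(1,2) by (rule finite_measure_lebesgue_on)
  define \<mu> where "\<mu> = measure lebesgue \<Omega>"
  have \<mu>: "(LINT x|?M. c) = c * \<mu>" for c :: real
    using \<Omega>(1) by (simp add: \<mu>_def measure_restrict_space)
  from w obtain g where wg: "in_H10 \<Omega> w g" and
    weak: "\<And>v h. in_H10 \<Omega> v h \<Longrightarrow> (LINT x|?M. g x \<bullet> h x) = (LINT x|?M. v x)"
    unfolding is_torsion_function_def by blast
  have L2: "L2 ?M w" "L2 ?M g" using wg by (auto simp: in_H10_def in_H1_def in_L2_iff)
  note [measurable] = L2[THEN L2_measurable]
  \<comment> \<open>Squares inside the domain satisfy L^2 \<le> 1440 * 3^9 * M; the added 1 makes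
    this side strictly too large.\<close>
  define L where "L = sqrt ((1440 * 3 ^ 9 + 1) * M)"
  have L: "0 < L" "L\<^sup>2 = (1440 * 3 ^ 9 + 1) * M" using M by (auto simp: L_def)
  have ns: "no_square \<Omega> L"
    unfolding no_square_def
  proof (intro allI notI)
    fix p assume "cbox p (p + L *\<^sub>R 1) \<subseteq> \<Omega>"
    then have "L\<^sup>2 \<le> 1440 * 3 ^ 9 * M"
      by (rule square_in_domain_bound[OF \<Omega>(1,2) wg _ bound L(1), rotated]) (rule weak)
    with L(2) M show False by (simp add: algebra_simps)
  qed
  obtain \<phi> where \<phi>: "\<And>n::nat. test_function \<Omega> (\<phi> n)"
    and lim: "(\<lambda>n. LINT x|?M. (norm (\<phi> n x - w x))\<^sup>2) \<longlonglongrightarrow> 0"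
      "(\<lambda>n. LINT x|?M. (norm (grad (\<phi> n) x - g x))\<^sup>2) \<longlonglongrightarrow> 0"
    using in_H10_approx[OF wg] by blast
  define e f where "e n = (LINT x|?M. (\<phi> n x - w x)\<^sup>2)" and "f n = (LINT x|?M. (norm (grad (\<phi> n) x - g x))\<^sup>2)" for n
  have e0: "e \<longlonglongrightarrow> 0" and f0: "f \<longlonglongrightarrow> 0"
    using lim by (simp_all add: e_def[abs_def] f_def[abs_def])
  define a where "a = pi / (2 * M)"
  have a: "0 < a" "a\<^sup>2 \<le> 4 / M\<^sup>2"
  proof -
    show "0 < a" using M by (simp add: a_def)
    have "a \<le> 2 / M" using M pi_less_4 by (simp add: a_def field_simps)
    then have "a\<^sup>2 \<le> (2 / M)\<^sup>2" using \<open>0 < a\<close> by (intro power_mono) auto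
    then show "a\<^sup>2 \<le> 4 / M\<^sup>2" by (simp add: power_divide)
  qed
  define X Y E where "X = (LINT x|?M. (cos (a * w x))\<^sup>2)" and "Y = (LINT x|?M. (sin (2 * a * w x))\<^sup>2)"
    and "E = (LINT x|?M. (norm (g x))\<^sup>2)"
  have iX: "integrable ?M (\<lambda>x. (cos (b * h x))\<^sup>2)" and iY: "integrable ?M (\<lambda>x. (sin (b * h x))\<^sup>2)"
    if [measurable]: "h \<in> borel_measurable ?M" for h :: "real^2 \<Rightarrow> real" and b
    by (auto intro!: integrable_const_bound[of _ 1] simp: abs_square_le_1)
  \<comment> \<open>the weight for which the energy term is at most half the area\<close>
  define \<kappa> where "\<kappa> = 8 * L * M"
  have \<kappa>: "0 < \<kappa>" using L M by (simp add: \<kappa>_def)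
  \<comment> \<open>Poincare for the squared sine of \<open>\<phi> n\<close>, whose integral is the
    area minus that of the squared cosine. All integrals are expressed through those of
    \<open>w\<close>, with errors \<open>e n\<close> and \<open>f n\<close> that vanish in the
    limit.\<close>
  have step: "\<mu> - 2 * X - 2 * a\<^sup>2 * e n
      \<le> L * (\<kappa> * a\<^sup>2 * (2 * Y + 8 * a\<^sup>2 * e n) + 2 / \<kappa> * (2 * E + 2 * f n))" for n
  proof -
    note L2\<phi> = L2_test_function[OF \<Omega>(1) \<phi>, of n]
    note [measurable] = L2\<phi>[THEN L2_measurable]
    have ie: "integrable ?M (\<lambda>x. (\<phi> n x - w x)\<^sup>2)"
      using L2_integrable_square[OF L2_diff[OF L2\<phi>(1) L2(1)]] by simp
    have if': "integrable ?M (\<lambda>x. (norm (grad (\<phi> n) x - g x))\<^sup>2)"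
      by (rule L2_integrable_square[OF L2_diff[OF L2\<phi>(2) L2(2)]])
    have "(LINT x|?M. (cos (a * \<phi> n x))\<^sup>2) \<le> (LINT x|?M. 2 * (cos (a * w x))\<^sup>2 + 2 * a\<^sup>2 * (\<phi> n x - w x)\<^sup>2)"
      by (intro integral_mono Bochner_Integration.integrable_add integrable_mult_right iX ie trig_perturbation) measurable
    also have "\<dots> = 2 * X + 2 * a\<^sup>2 * e n"
      using iX[of w a] ie by (simp add: X_def e_def)
    finally have 1: "(LINT x|?M. (cos (a * \<phi> n x))\<^sup>2) \<le> 2 * X + 2 * a\<^sup>2 * e n" .
    have "(LINT x|?M. (sin (2 * a * \<phi> n x))\<^sup>2) \<le> (LINT x|?M. 2 * (sin (2 * a * w x))\<^sup>2 + 2 * (2 * a)\<^sup>2 * (\<phi> n x - w x)\<^sup>2)"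
      by (intro integral_mono Bochner_Integration.integrable_add integrable_mult_right iY ie trig_perturbation) measurable
    also have "\<dots> = 2 * Y + 8 * a\<^sup>2 * e n"
      using iY[of w "2 * a"] ie by (simp add: Y_def e_def power_mult_distrib)
    finally have 2: "(LINT x|?M. (sin (2 * a * \<phi> n x))\<^sup>2) \<le> 2 * Y + 8 * a\<^sup>2 * e n" .
    have "(LINT x|?M. (norm (grad (\<phi> n) x))\<^sup>2) \<le> (LINT x|?M. 2 * (norm (g x))\<^sup>2 + 2 * (norm (grad (\<phi> n) x - g x))\<^sup>2)"
    proof (rule integral_mono)
      show "integrable ?M (\<lambda>x. (norm (grad (\<phi> n) x))\<^sup>2)" by (rule L2_integrable_square[OF L2\<phi>(2)])
      show "integrable ?M (\<lambda>x. 2 * (norm (g x))\<^sup>2 + 2 * (norm (grad (\<phi> n) x - g x))\<^sup>2)"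
        using L2_integrable_square[OF L2(2)] if' by simp
      show "(norm (grad (\<phi> n) x))\<^sup>2 \<le> 2 * (norm (g x))\<^sup>2 + 2 * (norm (grad (\<phi> n) x - g x))\<^sup>2" for x
        using power2_norm_add_le[of "g x" "grad (\<phi> n) x - g x"] by simp
    qed
    also have "\<dots> = 2 * E + 2 * f n"
      using L2_integrable_square[OF L2(2)] if' by (simp add: E_def f_def)
    finally have 3: "(LINT x|?M. (norm (grad (\<phi> n) x))\<^sup>2) \<le> 2 * E + 2 * f n" .
    have "(LINT x|?M. \<bar>(sin (a * \<phi> n x))\<^sup>2\<bar>) \<le> L * (\<kappa> * (LINT x|?M. (a * sin (2 * a * \<phi> n x))\<^sup>2)
      + 2 / \<kappa> * (LINT x|?M. (norm (grad (\<phi> n) x))\<^sup>2))"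
    proof (rule poincare_truncated[OF \<Omega> ns _ \<phi> _ _ _ \<kappa>, where h = "\<lambda>t. (sin (a * t))\<^sup>2"])
      show "((\<lambda>t. (sin (a * t))\<^sup>2) has_real_derivative a * sin (2 * a * t)) (at t)" for t
        using sin_double[of "a * t"] by (auto intro!: derivative_eq_intros simp: mult.assoc)
    qed (use L in \<open>auto intro!: continuous_intros\<close>)
    also have "\<dots> = L * (\<kappa> * a\<^sup>2 * (LINT x|?M. (sin (2 * a * \<phi> n x))\<^sup>2) + 2 / \<kappa> * (LINT x|?M. (norm (grad (\<phi> n) x))\<^sup>2))"
      by (simp add: power_mult_distrib)
    also have "\<dots> \<le> L * (\<kappa> * a\<^sup>2 * (2 * Y + 8 * a\<^sup>2 * e n) + 2 / \<kappa> * (2 * E + 2 * f n))"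
      using L(1) \<kappa> by (intro mult_left_mono add_mono 2 3) auto
    finally have "(LINT x|?M. (sin (a * \<phi> n x))\<^sup>2) \<le> L * (\<kappa> * a\<^sup>2 * (2 * Y + 8 * a\<^sup>2 * e n) + 2 / \<kappa> * (2 * E + 2 * f n))"
      by simp
    moreover have "(LINT x|?M. (sin (a * \<phi> n x))\<^sup>2) = \<mu> - (LINT x|?M. (cos (a * \<phi> n x))\<^sup>2)"
    proof -
      have "(LINT x|?M. (sin (a * \<phi> n x))\<^sup>2) = (LINT x|?M. 1 - (cos (a * \<phi> n x))\<^sup>2)"
        by (simp add: sin_squared_eq)
      also have "\<dots> = (LINT x|?M. 1) - (LINT x|?M. (cos (a * \<phi> n x))\<^sup>2)"
        by (intro Bochner_Integration.integral_diff iX) (auto simp: L2\<phi>[THEN L2_measurable])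
      finally show ?thesis unfolding \<mu> by simp
    qed
    ultimately show ?thesis using 1 by linarith
  qed
  have main: "\<mu> - 2 * X \<le> L * (\<kappa> * a\<^sup>2 * (2 * Y) + 2 / \<kappa> * (2 * E))"
  proof (rule LIMSEQ_le)
    have "(\<lambda>n. \<mu> - 2 * X - 2 * a\<^sup>2 * e n) \<longlonglongrightarrow> \<mu> - 2 * X - 2 * a\<^sup>2 * 0"
      by (intro tendsto_intros e0)
    then show "(\<lambda>n. \<mu> - 2 * X - 2 * a\<^sup>2 * e n) \<longlonglongrightarrow> \<mu> - 2 * X" by simp
    have "(\<lambda>n. L * (\<kappa> * a\<^sup>2 * (2 * Y + 8 * a\<^sup>2 * e n) + 2 / \<kappa> * (2 * E + 2 * f n)))
      \<longlonglongrightarrow> L * (\<kappa> * a\<^sup>2 * (2 * Y + 8 * a\<^sup>2 * 0) + 2 / \<kappa> * (2 * E + 2 * 0))"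
      by (intro tendsto_intros e0 f0)
    then show "(\<lambda>n. L * (\<kappa> * a\<^sup>2 * (2 * Y + 8 * a\<^sup>2 * e n) + 2 / \<kappa> * (2 * E + 2 * f n)))
      \<longlonglongrightarrow> L * (\<kappa> * a\<^sup>2 * (2 * Y) + 2 / \<kappa> * (2 * E))" by simp
  qed (use step in blast)
  have iw: "integrable ?M (\<lambda>x. \<bar>w x\<bar>)"
    using bound by (intro integrable_const_bound[of _ M]) auto
  define \<Delta> where "\<Delta> = (LINT x|?M. M - \<bar>w x\<bar>)"
  have \<Delta>: "\<Delta> = M * \<mu> - (LINT x|?M. \<bar>w x\<bar>)"
    unfolding \<Delta>_def \<mu>[symmetric] by (rule Bochner_Integration.integral_diff[OF _ iw]) simp
  have i\<Delta>: "integrable ?M (\<lambda>x. c * (M - \<bar>w x\<bar>))" for c using iw by simp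
  have "X \<le> (LINT x|?M. 4 / M * (M - \<bar>w x\<bar>))"
    unfolding X_def a_def
  proof (rule integral_mono_AE[OF iX i\<Delta>])
    show "AE x in ?M. (cos (pi / (2 * M) * w x))\<^sup>2 \<le> 4 / M * (M - \<bar>w x\<bar>)"
      using bound by eventually_elim (rule cos_quarter_period_le(1)[OF M])
  qed measurable
  then have X: "X \<le> 4 / M * \<Delta>" by (simp only: integral_mult_right_zero \<Delta>_def)
  have "Y \<le> (LINT x|?M. 16 / M * (M - \<bar>w x\<bar>))"
    unfolding Y_def a_def
  proof (rule integral_mono_AE[OF iY i\<Delta>])
    show "AE x in ?M. (sin (2 * (pi / (2 * M)) * w x))\<^sup>2 \<le> 16 / M * (M - \<bar>w x\<bar>)"
      using bound by eventually_elim (rule cos_quarter_period_le(2)[OF M])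
  qed measurable
  then have Y: "Y \<le> 16 / M * \<Delta>" by (simp only: integral_mult_right_zero \<Delta>_def)
  have Y0: "0 \<le> Y" by (simp add: Y_def)
  \<comment> \<open>The weak equation is tested with \<open>w\<close> itself.\<close>
  have "E = (LINT x|?M. w x)"
    using weak[OF wg] by (simp add: E_def power2_norm_eq_inner)
  also have "\<dots> \<le> (LINT x|?M. M)"
  proof (rule integral_mono_AE)
    show "integrable ?M w" using iw by (subst (asm) integrable_abs_iff) measurable
    show "AE x in ?M. w x \<le> M" using bound by eventually_elim simp
  qed simp
  finally have E: "E \<le> M * \<mu>" by (simp only: \<mu>)
  \<comment> \<open>The factor 1024 below is 8 * 4 * 2 * 16, from \<open>\<kappa>\<close>, the bound
    on \<open>a\<^sup>2\<close>, the perturbation loss and the bound on \<open>Y\<close>.\<close>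
  have "L * (\<kappa> * a\<^sup>2 * (2 * Y) + 2 / \<kappa> * (2 * E)) \<le> L * (\<kappa> * (4 / M\<^sup>2) * (2 * (16 / M * \<Delta>)) + 2 / \<kappa> * (2 * (M * \<mu>)))"
    using L(1) \<kappa> a Y Y0 E M by (intro mult_left_mono add_mono mult_mono) auto
  also have "\<dots> = 1024 * L\<^sup>2 * \<Delta> / M\<^sup>2 + \<mu> / 2"
    using L(1) M by (simp add: \<kappa>_def field_simps power2_eq_square)
  also have "1024 * L\<^sup>2 * \<Delta> / M\<^sup>2 = 1024 * (1440 * 3 ^ 9 + 1) * (\<Delta> / M)"
    using M unfolding L(2) by (simp add: power2_eq_square)
  finally have "\<mu> / 2 \<le> 8 * (\<Delta> / M) + 1024 * (1440 * 3 ^ 9 + 1) * (\<Delta> / M)"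
    using main X by simp
  \<comment> \<open>The number is 2 * (8 + 1024 * (1440 * 3^9 + 1)), the 8 coming from
    \<open>2 * X\<close>; rounding it up to 10^11 gives the final gap.\<close>
  then have "\<mu> \<le> 58047531024 * (\<Delta> / M)" by simp
  moreover have "0 \<le> \<mu>" by (simp add: \<mu>_def)
  ultimately have "\<mu> \<le> 100000000000 * (\<Delta> / M)" by argo
  then have "\<mu> \<le> 10 ^ 11 * (\<Delta> / M)" by simp
  then have "M * \<mu> / 10 ^ 11 \<le> \<Delta>" using M by (simp add: field_simps)
  then show ?thesis unfolding \<Delta> \<mu>_def by (simp add: algebra_simps)
qed

theorem corollary5:
  fixes \<Omega> :: "(real ^ 2) set"
  assumes "\<Omega> \<noteq> {}" and "open \<Omega>" and "simply_connected \<Omega>"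
    and "emeasure lebesgue \<Omega> < \<infinity>"
  shows "mean_to_max \<Omega> <
    (1 - 3 ^ 4 / (12801 * 2 ^ 31 * (1 + (pi + pi ^ 2) / 16) ^ 4)) *
    inverse (1 + 3 ^ 5 * (67 - 44 * sqrt 2) / (2 ^ 34 * 5 * 7 * j0) * c1)"
proof -
  let ?M = "lebesgue_on \<Omega>"
  define w where "w = torsion_function \<Omega>"
  define \<mu> where "\<mu> = measure lebesgue \<Omega>"
  define M where "M = Linf_norm \<Omega> w"
  \<comment> \<open>Existence is what gives the choice by \<open>SOME\<close> its defining
    property.\<close>
  have w: "is_torsion_function \<Omega> w"
    unfolding w_def torsion_function_def
    using torsion_function_exists[OF assms(2,4,3)] by (rule someI_ex)
  have I0: "0 \<le> L1_norm \<Omega> w" and \<mu>0: "0 \<le> \<mu>" by (simp_all add: L1_norm_def \<mu>_def)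
  have "mean_to_max \<Omega> \<le> 1 - 1 / 10 ^ 11"
  \<comment> \<open>An infinite essential supremum would be turned into \<open>M = 0\<close> by
    \<open>real_of_ereal\<close>, and division by 0 then gives ratio 0. In the first case
    \<open>M\<close> is the true supremum; in the second the ratio is at most 0.\<close>
  proof (cases "0 < M \<and> 0 < \<mu>")
    case True
    then have M: "0 < M" and \<mu>: "0 < \<mu>" by auto
    have M_ess: "esssup ?M (\<lambda>x. ereal \<bar>w x\<bar>) = ereal M"
      using M unfolding M_def Linf_norm_def by (cases "esssup ?M (\<lambda>x. ereal \<bar>w x\<bar>)") auto
    have "AE x in ?M. \<bar>w x\<bar> \<le> M"
      using esssup_AE[of "\<lambda>x. ereal \<bar>w x\<bar>" ?M] unfolding M_ess by simp
    then have "L1_norm \<Omega> w \<le> (1 - 1 / 10 ^ 11) * M * \<mu>"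
      unfolding L1_norm_def \<mu>_def by (rule torsion_mean_bound[OF assms(2,4,3) w _ M])
    then have "L1_norm \<Omega> w / (M * \<mu>) \<le> 1 - 1 / 10 ^ 11"
      using M \<mu> by (simp add: divide_le_eq mult.assoc)
    then show ?thesis by (simp add: mean_to_max_def mult.commute flip: w_def M_def \<mu>_def)
  next
    case False
    have "mean_to_max \<Omega> \<le> 0"
      unfolding mean_to_max_def w_def[symmetric] M_def[symmetric] \<mu>_def[symmetric]
    proof (cases "\<mu> = 0")
      case False
      with \<open>\<not> (0 < M \<and> 0 < \<mu>)\<close> \<mu>0 have "M \<le> 0" by auto
      then have "L1_norm \<Omega> w / M \<le> 0" using I0 by (rule divide_nonneg_nonpos[rotated])
      then show "1 / \<mu> * (L1_norm \<Omega> w / M) \<le> 0" using \<mu>0 by (intro mult_nonneg_nonpos) auto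
    qed simp
    also have "0 \<le> 1 - 1 / (10::real) ^ 11" by simp
    finally show ?thesis by simp
  qed
  with ratio_bound_lower show ?thesis by linarith
qed

end
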